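(* The singular crossing bimodule ${}^\vee X:={}^\vee Y\boxtimes{}^\vee\Lambda$ (equivalently the left dual of $X:=\Lambda\boxtimes Y$) is a well-defined AD bimodule over $(\mathcal A_{1,1},\mathcal A_{1,1})$, and it categorifies the $U_q(\mathfrak{gl}(1|1))$-intertwining map $V^{\otimes2}\to V^{\otimes2}$ for a singular crossing, i.e. the composite $1_{1,1}F_{\mathfrak{gl}(2)}1_{2,0}E_{\mathfrak{gl}(2)}1_{1,1}$. In the ordered basis $[S_{\mathrm{uu}}],[S_{\mathrm{ou}}],[S_{\mathrm{uo}}],[S_{\mathrm{oo}}]$ of $G_0(\mathcal A_{1,1})$, identified with $|00\rangle,|10\rangle,|01\rangle,|11\rangle$, $$[{}^\vee X]=\begin{pmatrix}0&0&0&0\\0&q&-1&0\\0&-1&q^{-1}&0\\0&0&0&q+q^{-1}\end{pmatrix}.$$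
   Context: **Conventions.** Ground field $\mathbb F_2$. Everything is bigraded by $(\deg^q,\deg^h)\in\mathbb Z^2$; products and actions have bidegree $(0,0)$, differentials $(0,1)$. $q^iW[j]$ is $W$ with $\deg^q$ shifted up by $i$, $\deg^h$ shifted down by $j$. Bidegrees are written $(\deg^q,\deg^h)$. For a dg category $A$ with finitely many objects put $A(T,S)=\mathrm{Hom}_A(S,T)$, products being compositions; $I\subset A$ is the subcategory of identity morphisms. An $(I',I)$-bimodule is a family $M(S',S)$ of bigraded vector spaces. **DA bimodules.** A DA bimodule over $(A',A)$ is an $(I',I)$-bimodule $M$ with bidegree-zero bilinear maps $\delta^1_i:M\otimes_I(A[1])^{\otimes(i-1)}\to A'[1]\otimes_{I'}M$, $i\ge1$, with, for all $i$, $$\sum_{j=1}^i(\mu'\otimes\mathrm{id})(\mathrm{id}\otimes\delta^1_{i-j+1})(\delta^1_j\otimes\mathrm{id})+\sum_{j=1}^{i-1}\delta^1_i(\mathrm{id}\otimes\partial_j)+\sum_{j=1}^{i-2}\delta^1_{i-1}(\mathrm{id}\otimes\mu_{j,j+1})+(\partial'\otimes\mathrm{id})\delta^1_i=0 .$$ Strict unitality: $\delta^1_2(m,\mathrm{id})=\mathrm{id}\otimes m$ and $\delta^1_i$ ($i>2$) vanishes if an input is an identity. We write $\delta(m;a_1,\dots,a_{i-1})=a'm'$ for $\delta^1_i(m\otimes a_1\otimes\cdots\otimes a_{i-1})=a'\otimes m'$; operations on basis elements with non-identity inputs that are not listed are zero; $k\ge0$ is arbitrary. If $\delta^1_i=0$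 for $i>2$ we write $\partial m$ for $\delta^1_1$, $m\cdot a$ for $\delta^1_2$, and list the right action of algebra generators. Box tensor product: for $M$ over $(A'',A')$ and $N$ over $(A',A)$, $M\boxtimes N$ has underlying bimodule $M\otimes_{I'}N$ and operations $\sum_{j\ge0}(\delta^{1,M}_{j+1}\otimes\mathrm{id}_N)\circ(\mathrm{id}_M\otimes\delta^{j,N})$, where $\delta^{j,N}$ is the $j$-fold iterate of $\delta^{1,N}$ (outputting $j$ elements of $A'$ in order, consuming the inputs from $A$ in order). **AD bimodules and duals.** AD bimodules and their box tensor products are defined by interchanging left and right. For a finitely generated DA bimodule $M$ over $(A',A)$, the left dual ${}^\vee M$ is the AD bimodule over $(A,A')$ with ${}^\vee M(S,S')=M(S',S)^*$ (bidegrees negated), whose operations are the transposes: $\delta(m;a_1,\dots,a_n)$ contains $a'm'$ iff the operation on $a_1\otimes\cdots\otimes a_n\otimes (m')^*$ contains $m^*\otimes a'$. One has ${}^\vee(M_1\boxtimes M_2)={}^\vee M_2\boxtimes{}^\vee M_1$. **Algebras.** $\mathcal A_2$: objects $\mathrm u,\mathrm o$; $\mathcal A_2(\mathrm u,\mathrm u)=\mathbb F_2[e_1]$, $\mathcal A_2(\mathrm o,\mathrm o)=\mathbb F_2[e_1,e_2]$, no morphisms between distinct objects; $e_i$ has bidegree $(-2i,2i)$. $\mathcal A_{1,1}$: objects $\mathrm{uu},\mathrm{ou},\mathrm{uo},\mathrm{oo}$; endomorphism algebras $\mathbb F_2$, $\mathbb F_2[U_1]$, $\mathbb F_2[U_2]$,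 $\mathbb F_2[U_1,U_2]$ respectively; $\mathcal A_{1,1}(\mathrm{uo},\mathrm{ou})=\mathbb F_2\lambda$ with $\lambda U_1=0=U_2\lambda$; all other morphism spaces zero; $U_i$ has bidegree $(-2,2)$, $\lambda$ has bidegree $(1,0)$. Zero differentials. **$\Lambda$** (DA over $(\mathcal A_{1,1},\mathcal A_2)$): basis $x\in\Lambda(\mathrm{ou},\mathrm u)$ of bidegree $(-1,1)$, $y\in\Lambda(\mathrm{uo},\mathrm u)$ of bidegree $(0,0)$, $z\in\Lambda(\mathrm{oo},\mathrm o)$ of bidegree $(0,0)$; $\partial y=\lambda x$; $x\cdot e_1=U_1x$, $y\cdot e_1=U_2y$; $z\cdot e_1=(U_1+U_2)z$, $z\cdot e_2=U_1U_2z$. **$Y$** (DA over $(\mathcal A_2,\mathcal A_{1,1})$): basis $a\in Y(\mathrm u,\mathrm{ou})$ of bidegree $(0,1)$, $b\in Y(\mathrm u,\mathrm{uo})$ of bidegree $(1,0)$, $c,d\in Y(\mathrm o,\mathrm{oo})$ of bidegrees $(-1,2)$, $(1,0)$; $\delta(a;U_1^{k+1})=e_1^{k+1}a$, $\delta(b;U_2^{k+1})=e_1^{k+1}b$, $\delta(b;\lambda,U_1^{k+1})=e_1^ka$, $\delta(b;U_2^{k+1},\lambda)=e_1^ka$; $c\cdot U_1=e_1c+e_2d$, $d\cdot U_1=c$, $c\cdot U_2=e_2d$, $d\cdot U_2=c+e_1d$. **Decategorification.** $G_0(A)$ is the $\mathbb C(q)$-vector space with basis $[S_s]$, $s$ an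 object of $A$. A finitely generated AD bimodule $N$ over $(A',A)$ induces $[N]:G_0(A)\to G_0(A')$ whose entry in row $[S_{s'}]$, column $[S_s]$ is $\sum(-1)^{\deg^h}q^{\deg^q}$ over a homogeneous basis of $N(s',s)$; "$N$ categorifies $\phi$" means $[N]=\phi$. **Representations.** $U_q(\mathfrak{gl}(1|1))$ has odd generators $E,F$, even $q^{\pm H_1},q^{\pm H_2}$, with $\Delta(E)=E\otimes q^{-H_1-H_2}+1\otimes E$, $\Delta(F)=F\otimes1+q^{H_1+H_2}\otimes F$, $\Delta(q^{H_i})=q^{H_i}\otimes q^{H_i}$. $V$ has even basis vector $|0\rangle$ and odd $|1\rangle$, $E|1\rangle=|0\rangle$, $F|0\rangle=|1\rangle$, $E|0\rangle=F|1\rangle=0$, $q^{H_1}$ acts by $q,1$ and $q^{H_2}$ by $1,q$. The skew Howe maps are $1_{2,0}E_{\mathfrak{gl}(2)}1_{1,1}:V^{\otimes2}\to\wedge^2_qV$, $|00\rangle\mapsto0$, $|10\rangle\mapsto-q|0\rangle\wedge|1\rangle$, $|01\rangle\mapsto|0\rangle\wedge|1\rangle$, $|11\rangle\mapsto|1\rangle\wedge|1\rangle$, and $1_{1,1}F_{\mathfrak{gl}(2)}1_{2,0}:\wedge_q^2V\to V^{\otimes2}$, $|0\rangle\wedge|1\rangle\mapsto-|10\rangle+q^{-1}|01\rangle$, $|1\rangle\wedge|1\rangle\mapsto(q+q^{-1})|11\rangle$; the singular crossing map is their composite. *)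

theory Defs
  imports
    "HOL-Library.Z2"
    "HOL-Library.Poly_Mapping"
    "HOL-Computational_Algebra.Polynomial"
    "HOL-Computational_Algebra.Fraction_Field"
    "HOL-Analysis.Cartesian_Space"
begin

section \<open>Bigraded vector spaces over the field with two elements\<close>

text \<open>
  A bigraded vector space over \<open>\<FF>\<^sub>2\<close> is given by a homogeneous basis: it is the free space
  \<^typ>\<open>'b \<Rightarrow>\<^sub>0 bit\<close> (finitely supported functions), and degrees are attached to basis elements.
  The tensor product of the spaces on \<^typ>\<open>'b\<close> and \<^typ>\<open>'c\<close> is the space on pairs, a tensor
  power of a category has lists as basis, and a tensor product over the identity morphisms is
  spanned by the pairs (lists) whose objects match.
\<close>

abbreviation basis_vec :: "'b \<Rightarrow> 'b \<Rightarrow>\<^sub>0 bit"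
  where "basis_vec b \<equiv> Poly_Mapping.single b 1"

text \<open>Linear extension of a map given on basis elements (all nonzero coefficients are 1).\<close>

definition lin :: "('b \<Rightarrow> 'c \<Rightarrow>\<^sub>0 bit) \<Rightarrow> ('b \<Rightarrow>\<^sub>0 bit) \<Rightarrow> ('c \<Rightarrow>\<^sub>0 bit)"
  where "lin f v = (\<Sum>b\<in>Poly_Mapping.keys v. f b)"


section \<open>dg categories\<close>

text \<open>
  \<^typ>\<open>'a\<close> is a homogeneous basis of all morphisms, containing the identities.  A basis element
  with \<open>lft a = T\<close> and \<open>rgt a = S\<close> lies in \<open>A(T,S) = Hom(S,T)\<close>; \<open>mul a b\<close> is the composite
  \<open>a \<circ> b\<close>, set to zero if \<open>a\<close> and \<open>b\<close> are not composable.
\<close>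

record ('o, 'a) dgcat =
  lft :: "'a \<Rightarrow> 'o"
  rgt :: "'a \<Rightarrow> 'o"
  cat_q :: "'a \<Rightarrow> int"
  cat_h :: "'a \<Rightarrow> int"
  ident :: "'o \<Rightarrow> 'a"
  mul :: "'a \<Rightarrow> 'a \<Rightarrow> 'a \<Rightarrow>\<^sub>0 bit"
  dif :: "'a \<Rightarrow> 'a \<Rightarrow>\<^sub>0 bit"

locale dg_category =
  fixes A :: "('o::finite, 'a) dgcat"
  assumes ident_obj: "lft A (ident A s) = s" "rgt A (ident A s) = s"
    and mul_noncomp: "rgt A a \<noteq> lft A b \<Longrightarrow> mul A a b = 0"
    and mul_obj: "c \<in> Poly_Mapping.keys (mul A a b) \<Longrightarrow> lft A c = lft A a \<and> rgt A c = rgt A b"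
    and mul_deg: "c \<in> Poly_Mapping.keys (mul A a b) \<Longrightarrow>
          cat_q A c = cat_q A a + cat_q A b \<and> cat_h A c = cat_h A a + cat_h A b"
    and mul_ident: "mul A (ident A (lft A a)) a = basis_vec a"
          "mul A a (ident A (rgt A a)) = basis_vec a"
    and mul_assoc: "lin (\<lambda>d. mul A d c) (mul A a b) = lin (mul A a) (mul A b c)"
    and dif_obj: "c \<in> Poly_Mapping.keys (dif A a) \<Longrightarrow> lft A c = lft A a \<and> rgt A c = rgt A a"
    and dif_deg: "c \<in> Poly_Mapping.keys (dif A a) \<Longrightarrow>
          cat_q A c = cat_q A a \<and> cat_h A c = cat_h A a + 1"
    and dif_dif: "lin (dif A) (dif A a) = 0"
    and leibniz: "lin (dif A) (mul A a b) =
          lin (\<lambda>d. mul A d b) (dif A a) + lin (mul A a) (dif A b)"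

text \<open>\<open>path A s as t\<close>: \<open>a\<^sub>1 \<otimes> \<dots> \<otimes> a\<^sub>n\<close> is a basis element of the tensor power of
  \<open>A\<close> over the identities, with leftmost object \<open>s\<close> and rightmost object \<open>t\<close>.\<close>

fun path :: "('o, 'a) dgcat \<Rightarrow> 'o \<Rightarrow> 'a list \<Rightarrow> 'o \<Rightarrow> bool"
  where
    "path A s [] t \<longleftrightarrow> s = t"
  | "path A s (a # as) t \<longleftrightarrow> lft A a = s \<and> path A (rgt A a) as t"

text \<open>Input degrees in \<open>A[1]\<^sup>\<otimes>\<^sup>n\<close>; the shift \<open>[1]\<close> lowers the homological degree by one.\<close>

definition inputs_q :: "('o, 'a) dgcat \<Rightarrow> 'a list \<Rightarrow> int"
  where "inputs_q A as = (\<Sum>a\<leftarrow>as. cat_q A a)"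

definition inputs_h :: "('o, 'a) dgcat \<Rightarrow> 'a list \<Rightarrow> int"
  where "inputs_h A as = (\<Sum>a\<leftarrow>as. cat_h A a - 1)"


section \<open>DA and AD bimodules\<close>

text \<open>A basis element \<open>m\<close> lies in \<open>M(lid m, rid m)\<close>.\<close>

record ('l, 'r, 'b) ibimod =
  gens :: "'b set"
  lid :: "'b \<Rightarrow> 'l"
  rid :: "'b \<Rightarrow> 'r"
  qdeg :: "'b \<Rightarrow> int"
  hdeg :: "'b \<Rightarrow> int"

text \<open>\<open>da_op M m [a\<^sub>1, \<dots>, a\<^sub>n]\<close> is \<open>\<delta>\<^sup>1\<^sub>n\<^sub>+\<^sub>1(m \<otimes> a\<^sub>1 \<otimes> \<dots> \<otimes> a\<^sub>n)\<close> and
  \<open>ad_op N [a\<^sub>1, \<dots>, a\<^sub>n] m\<close> is the mirror operation on \<open>a\<^sub>1 \<otimes> \<dots> \<otimes> a\<^sub>n \<otimes> m\<close>.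
  Only the values on matching inputs are meaningful.\<close>

record ('l, 'r, 'c, 'a, 'b) da = "('l, 'r, 'b) ibimod" +
  da_op :: "'b \<Rightarrow> 'a list \<Rightarrow> ('c \<times> 'b) \<Rightarrow>\<^sub>0 bit"

record ('l, 'r, 'c, 'a, 'b) ad = "('l, 'r, 'b) ibimod" +
  ad_op :: "'c list \<Rightarrow> 'b \<Rightarrow> ('b \<times> 'a) \<Rightarrow>\<^sub>0 bit"

locale da_bimodule =
  A': dg_category A' + A: dg_category A
  for A' :: "('l::finite, 'c) dgcat" and A :: "('r::finite, 'a) dgcat" +
  fixes M :: "('l, 'r, 'c, 'a, 'b) da"
  assumes op_obj: "\<lbrakk>m \<in> gens M; path A (rid M m) as t; (c, n) \<in> Poly_Mapping.keys (da_op M m as)\<rbrakk> \<Longrightarrow>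
        n \<in> gens M \<and> lft A' c = lid M m \<and> rgt A' c = lid M n \<and> rid M n = t"
    and op_deg: "\<lbrakk>m \<in> gens M; path A (rid M m) as t; (c, n) \<in> Poly_Mapping.keys (da_op M m as)\<rbrakk> \<Longrightarrow>
        qdeg M m + inputs_q A as = cat_q A' c + qdeg M n \<and>
        hdeg M m + inputs_h A as = (cat_h A' c - 1) + hdeg M n"
    and relation: "\<lbrakk>m \<in> gens M; path A (rid M m) as t\<rbrakk> \<Longrightarrow>
        (\<Sum>k\<le>length as.
           lin (\<lambda>(c, n).
             lin (\<lambda>(c', n'). lin (\<lambda>p. basis_vec (p, n')) (mul A' c c')) (da_op M n (drop k as)))
           (da_op M m (take k as)))
        + (\<Sum>j<length as. lin (\<lambda>a. da_op M m (as[j := a])) (dif A (as ! j)))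
        + (\<Sum>j<length as - 1.
             lin (\<lambda>a. da_op M m (take j as @ a # drop (j + 2) as)) (mul A (as ! j) (as ! (j + 1))))
        + lin (\<lambda>(c, n). lin (\<lambda>p. basis_vec (p, n)) (dif A' c)) (da_op M m as) = 0"
    and unit_2: "m \<in> gens M \<Longrightarrow> da_op M m [ident A (rid M m)] = basis_vec (ident A' (lid M m), m)"
    and unit_higher: "\<lbrakk>m \<in> gens M; path A (rid M m) as t; length as > 1; ident A s \<in> set as\<rbrakk> \<Longrightarrow>
        da_op M m as = 0"

locale ad_bimodule =
  A': dg_category A' + A: dg_category A
  for A' :: "('l::finite, 'c) dgcat" and A :: "('r::finite, 'a) dgcat" +
  fixes N :: "('l, 'r, 'c, 'a, 'b) ad"
  assumes op_obj: "\<lbrakk>m \<in> gens N; path A' s cs (lid N m); (n, a) \<in> Poly_Mapping.keys (ad_op N cs m)\<rbrakk> \<Longrightarrow>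
        n \<in> gens N \<and> rgt A a = rid N m \<and> lft A a = rid N n \<and> lid N n = s"
    and op_deg: "\<lbrakk>m \<in> gens N; path A' s cs (lid N m); (n, a) \<in> Poly_Mapping.keys (ad_op N cs m)\<rbrakk> \<Longrightarrow>
        inputs_q A' cs + qdeg N m = qdeg N n + cat_q A a \<and>
        inputs_h A' cs + hdeg N m = hdeg N n + (cat_h A a - 1)"
    and relation: "\<lbrakk>m \<in> gens N; path A' s cs (lid N m)\<rbrakk> \<Longrightarrow>
        (\<Sum>k\<le>length cs.
           lin (\<lambda>(n, a).
             lin (\<lambda>(n', a'). lin (\<lambda>p. basis_vec (n', p)) (mul A a' a)) (ad_op N (take k cs) n))
           (ad_op N (drop k cs) m))
        + (\<Sum>j<length cs. lin (\<lambda>c. ad_op N (cs[j := c]) m) (dif A' (cs ! j)))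
        + (\<Sum>j<length cs - 1.
             lin (\<lambda>c. ad_op N (take j cs @ c # drop (j + 2) cs) m) (mul A' (cs ! j) (cs ! (j + 1))))
        + lin (\<lambda>(n, a). lin (\<lambda>p. basis_vec (n, p)) (dif A a)) (ad_op N cs m) = 0"
    and unit_2: "m \<in> gens N \<Longrightarrow> ad_op N [ident A' (lid N m)] m = basis_vec (m, ident A (rid N m))"
    and unit_higher: "\<lbrakk>m \<in> gens N; path A' s cs (lid N m); length cs > 1; ident A' r \<in> set cs\<rbrakk> \<Longrightarrow>
        ad_op N cs m = 0"


section \<open>Box tensor products\<close>

text \<open>The iterates \<open>\<delta>\<^sup>j\<close>: the inputs are cut into \<open>j\<close> (possibly empty) consecutive blocks, and the
  \<open>j\<close> outputs are collected in order.\<close>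

fun da_iter :: "('l, 'r, 'c, 'a, 'b) da \<Rightarrow> nat \<Rightarrow> 'b \<Rightarrow> 'a list \<Rightarrow> ('c list \<times> 'b) \<Rightarrow>\<^sub>0 bit"
  where
    "da_iter N 0 n as = (if as = [] then basis_vec ([], n) else 0)"
  | "da_iter N (Suc j) n as =
       (\<Sum>k\<le>length as.
          lin (\<lambda>(c, n'). lin (\<lambda>(cs, n''). basis_vec (c # cs, n'')) (da_iter N j n' (drop k as)))
            (da_op N n (take k as)))"

fun ad_iter :: "('l, 'r, 'c, 'a, 'b) ad \<Rightarrow> nat \<Rightarrow> 'c list \<Rightarrow> 'b \<Rightarrow> ('b \<times> 'a list) \<Rightarrow>\<^sub>0 bit"
  where
    "ad_iter N 0 cs n = (if cs = [] then basis_vec (n, []) else 0)"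
  | "ad_iter N (Suc j) cs n =
       (\<Sum>k\<le>length cs.
          lin (\<lambda>(n', a). lin (\<lambda>(n'', as). basis_vec (n'', as @ [a])) (ad_iter N j (take k cs) n'))
            (ad_op N (drop k cs) n))"

definition da_box_term ::
    "('k, 'l, 'd, 'c, 'm) da \<Rightarrow> ('l, 'r, 'c, 'a, 'n) da \<Rightarrow> nat \<Rightarrow> 'm \<times> 'n \<Rightarrow> 'a list \<Rightarrow>
     ('d \<times> ('m \<times> 'n)) \<Rightarrow>\<^sub>0 bit"
  where "da_box_term M N j = (\<lambda>(m, n) as.
    lin (\<lambda>(cs, n'). lin (\<lambda>(d, m'). basis_vec (d, (m', n'))) (da_op M m cs)) (da_iter N j n as))"

definition ad_box_term ::
    "('k, 'l, 'd, 'c, 'm) ad \<Rightarrow> ('l, 'r, 'c, 'a, 'n) ad \<Rightarrow> nat \<Rightarrow> 'd list \<Rightarrow> 'm \<times> 'n \<Rightarrow>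
     (('m \<times> 'n) \<times> 'a) \<Rightarrow>\<^sub>0 bit"
  where "ad_box_term M N j ds = (\<lambda>(m, n).
    lin (\<lambda>(m', cs). lin (\<lambda>(n', a). basis_vec ((m', n'), a)) (ad_op N cs n)) (ad_iter M j ds m))"

text \<open>\<^const>\<open>Sum_any\<close> is the sum of the nonzero terms; it is meaningful only if they are finitely
  many, which is what \<open>da_box_defined\<close> and \<open>ad_box_defined\<close> below require.\<close>

definition da_box :: "('k, 'l, 'd, 'c, 'm) da \<Rightarrow> ('l, 'r, 'c, 'a, 'n) da \<Rightarrow>
    ('k, 'r, 'd, 'a, 'm \<times> 'n) da"
  where "da_box M N =
    \<lparr> gens = {(m, n). m \<in> gens M \<and> n \<in> gens N \<and> rid M m = lid N n},
      lid = (\<lambda>(m, n). lid M m),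
      rid = (\<lambda>(m, n). rid N n),
      qdeg = (\<lambda>(m, n). qdeg M m + qdeg N n),
      hdeg = (\<lambda>(m, n). hdeg M m + hdeg N n),
      da_op = (\<lambda>mn as. Sum_any (\<lambda>j. da_box_term M N j mn as)) \<rparr>"

definition ad_box :: "('k, 'l, 'd, 'c, 'm) ad \<Rightarrow> ('l, 'r, 'c, 'a, 'n) ad \<Rightarrow>
    ('k, 'r, 'd, 'a, 'm \<times> 'n) ad"
  where "ad_box M N =
    \<lparr> gens = {(m, n). m \<in> gens M \<and> n \<in> gens N \<and> rid M m = lid N n},
      lid = (\<lambda>(m, n). lid M m),
      rid = (\<lambda>(m, n). rid N n),
      qdeg = (\<lambda>(m, n). qdeg M m + qdeg N n),
      hdeg = (\<lambda>(m, n). hdeg M m + hdeg N n),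
      ad_op = (\<lambda>ds mn. Sum_any (\<lambda>j. ad_box_term M N j ds mn)) \<rparr>"

definition da_box_defined ::
    "('r, 'a) dgcat \<Rightarrow> ('k, 'l, 'd, 'c, 'm) da \<Rightarrow> ('l, 'r, 'c, 'a, 'n) da \<Rightarrow> bool"
  where "da_box_defined A M N \<longleftrightarrow>
    (\<forall>mn\<in>gens (da_box M N). \<forall>as t. path A (rid (da_box M N) mn) as t \<longrightarrow>
       finite {j. da_box_term M N j mn as \<noteq> 0})"

definition ad_box_defined ::
    "('k, 'd) dgcat \<Rightarrow> ('k, 'l, 'd, 'c, 'm) ad \<Rightarrow> ('l, 'r, 'c, 'a, 'n) ad \<Rightarrow> bool"
  where "ad_box_defined A'' M N \<longleftrightarrow>
    (\<forall>mn\<in>gens (ad_box M N). \<forall>ds s. path A'' s ds (lid (ad_box M N) mn) \<longrightarrow>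
       finite {j. ad_box_term M N j ds mn \<noteq> 0})"


section \<open>Left duals\<close>

text \<open>The basis element \<open>m\<close> of \<open>left_dual M\<close> stands for the dual basis vector \<open>m\<^sup>*\<close>.  The sum
  requires \<open>gens M\<close> to be finite.\<close>

definition left_dual :: "('l, 'r, 'c, 'a, 'b) da \<Rightarrow> ('r, 'l, 'a, 'c, 'b) ad"
  where "left_dual M =
    \<lparr> gens = gens M,
      lid = rid M,
      rid = lid M,
      qdeg = (\<lambda>m. - qdeg M m),
      hdeg = (\<lambda>m. - hdeg M m),
      ad_op = (\<lambda>as m'. \<Sum>m\<in>gens M.
        lin (\<lambda>(c, n). if n = m' then basis_vec (m, c) else 0) (da_op M m as)) \<rparr>"

text \<open>Identification of AD bimodules over \<open>(A', A)\<close> along a bijection of their bases.\<close>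

definition ad_iso_by ::
    "('l, 'c) dgcat \<Rightarrow> ('b \<Rightarrow> 'b') \<Rightarrow> ('l, 'r, 'c, 'a, 'b) ad \<Rightarrow> ('l, 'r, 'c, 'a, 'b') ad \<Rightarrow> bool"
  where "ad_iso_by A' f N N' \<longleftrightarrow>
    bij_betw f (gens N) (gens N') \<and>
    (\<forall>n\<in>gens N. lid N' (f n) = lid N n \<and> rid N' (f n) = rid N n \<and>
       qdeg N' (f n) = qdeg N n \<and> hdeg N' (f n) = hdeg N n) \<and>
    (\<forall>n\<in>gens N. \<forall>s cs. path A' s cs (lid N n) \<longrightarrow>
       ad_op N' cs (f n) = lin (\<lambda>(m, a). basis_vec (f m, a)) (ad_op N cs n))"


section \<open>The algebras\<close>

datatype obj2 = Obj_u | Obj_o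

datatype obj11 = Obj_uu | Obj_ou | Obj_uo | Obj_oo

instance obj2 :: finite
proof
  have "(UNIV :: obj2 set) = {Obj_u, Obj_o}"
    using obj2.exhaust by auto
  then show "finite (UNIV :: obj2 set)"
    by (metis finite.emptyI finite_insert)
qed

instance obj11 :: finite
proof
  have "(UNIV :: obj11 set) = {Obj_uu, Obj_ou, Obj_uo, Obj_oo}"
    using obj11.exhaust by auto
  then show "finite (UNIV :: obj11 set)"
    by (metis finite.emptyI finite_insert)
qed

text \<open>\<open>Mon_u i\<close> is \<open>e\<^sub>1\<^sup>i\<close> at \<open>u\<close>, and \<open>Mon_o i j\<close> is \<open>e\<^sub>1\<^sup>i e\<^sub>2\<^sup>j\<close> at \<open>o\<close>.\<close>

datatype mon2 = Mon_u nat | Mon_o nat nat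

fun obj_mon2 :: "mon2 \<Rightarrow> obj2"
  where
    "obj_mon2 (Mon_u i) = Obj_u"
  | "obj_mon2 (Mon_o i j) = Obj_o"

fun h_mon2 :: "mon2 \<Rightarrow> int"
  where
    "h_mon2 (Mon_u i) = 2 * int i"
  | "h_mon2 (Mon_o i j) = 2 * int i + 4 * int j"

fun mul_mon2 :: "mon2 \<Rightarrow> mon2 \<Rightarrow> mon2 \<Rightarrow>\<^sub>0 bit"
  where
    "mul_mon2 (Mon_u i) (Mon_u i') = basis_vec (Mon_u (i + i'))"
  | "mul_mon2 (Mon_o i j) (Mon_o i' j') = basis_vec (Mon_o (i + i') (j + j'))"
  | "mul_mon2 _ _ = 0"

definition A2 :: "(obj2, mon2) dgcat"
  where "A2 =
    \<lparr> lft = obj_mon2, rgt = obj_mon2,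
      cat_q = (\<lambda>a. - h_mon2 a), cat_h = h_mon2,
      ident = (\<lambda>s. case s of Obj_u \<Rightarrow> Mon_u 0 | Obj_o \<Rightarrow> Mon_o 0 0),
      mul = mul_mon2, dif = (\<lambda>_. 0) \<rparr>"

text \<open>\<open>M_uu\<close> is the identity at \<open>uu\<close>, \<open>M_ou i\<close> is \<open>U\<^sub>1\<^sup>i\<close> at \<open>ou\<close>, \<open>M_uo j\<close> is \<open>U\<^sub>2\<^sup>j\<close> at
  \<open>uo\<close>, \<open>M_oo i j\<close> is \<open>U\<^sub>1\<^sup>i U\<^sub>2\<^sup>j\<close> at \<open>oo\<close>, and \<open>Lam\<close> is \<open>\<lambda> : ou \<rightarrow> uo\<close>.\<close>

datatype mon11 = M_uu | M_ou nat | M_uo nat | M_oo nat nat | Lam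

fun lft_mon11 :: "mon11 \<Rightarrow> obj11"
  where
    "lft_mon11 M_uu = Obj_uu"
  | "lft_mon11 (M_ou i) = Obj_ou"
  | "lft_mon11 (M_uo j) = Obj_uo"
  | "lft_mon11 (M_oo i j) = Obj_oo"
  | "lft_mon11 Lam = Obj_uo"

fun rgt_mon11 :: "mon11 \<Rightarrow> obj11"
  where
    "rgt_mon11 M_uu = Obj_uu"
  | "rgt_mon11 (M_ou i) = Obj_ou"
  | "rgt_mon11 (M_uo j) = Obj_uo"
  | "rgt_mon11 (M_oo i j) = Obj_oo"
  | "rgt_mon11 Lam = Obj_ou"

fun q_mon11 :: "mon11 \<Rightarrow> int"
  where
    "q_mon11 M_uu = 0"
  | "q_mon11 (M_ou i) = - 2 * int i"
  | "q_mon11 (M_uo j) = - 2 * int j"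
  | "q_mon11 (M_oo i j) = - 2 * int i - 2 * int j"
  | "q_mon11 Lam = 1"

fun h_mon11 :: "mon11 \<Rightarrow> int"
  where
    "h_mon11 M_uu = 0"
  | "h_mon11 (M_ou i) = 2 * int i"
  | "h_mon11 (M_uo j) = 2 * int j"
  | "h_mon11 (M_oo i j) = 2 * int i + 2 * int j"
  | "h_mon11 Lam = 0"

fun mul_mon11 :: "mon11 \<Rightarrow> mon11 \<Rightarrow> mon11 \<Rightarrow>\<^sub>0 bit"
  where
    "mul_mon11 M_uu M_uu = basis_vec M_uu"
  | "mul_mon11 (M_ou i) (M_ou i') = basis_vec (M_ou (i + i'))"
  | "mul_mon11 (M_uo j) (M_uo j') = basis_vec (M_uo (j + j'))"
  | "mul_mon11 (M_oo i j) (M_oo i' j') = basis_vec (M_oo (i + i') (j + j'))"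
  | "mul_mon11 (M_uo j) Lam = (if j = 0 then basis_vec Lam else 0)"
  | "mul_mon11 Lam (M_ou i) = (if i = 0 then basis_vec Lam else 0)"
  | "mul_mon11 _ _ = 0"

definition A11 :: "(obj11, mon11) dgcat"
  where "A11 =
    \<lparr> lft = lft_mon11, rgt = rgt_mon11,
      cat_q = q_mon11, cat_h = h_mon11,
      ident = (\<lambda>s. case s of Obj_uu \<Rightarrow> M_uu | Obj_ou \<Rightarrow> M_ou 0 | Obj_uo \<Rightarrow> M_uo 0
                           | Obj_oo \<Rightarrow> M_oo 0 0),
      mul = mul_mon11, dif = (\<lambda>_. 0) \<rparr>"


section \<open>The bimodules \<open>\<Lambda>\<close> and \<open>Y\<close>\<close>

text \<open>The right action of a word \<open>g\<^sub>1 \<dots> g\<^sub>n\<close> in algebra generators, from the action \<open>step\<close> of single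
  generators: if \<open>m \<cdot> g = \<Sum> c m'\<close> and \<open>m' \<cdot> w = \<Sum> c' m''\<close>, then \<open>m \<cdot> gw = \<Sum> c c' m''\<close>.\<close>

fun word_act :: "('l, 'c) dgcat \<Rightarrow> ('b \<Rightarrow> 'l) \<Rightarrow> ('b \<Rightarrow> 'g \<Rightarrow> ('c \<times> 'b) \<Rightarrow>\<^sub>0 bit) \<Rightarrow>
    'b \<Rightarrow> 'g list \<Rightarrow> ('c \<times> 'b) \<Rightarrow>\<^sub>0 bit"
  where
    "word_act A' l step m [] = basis_vec (ident A' (l m), m)"
  | "word_act A' l step m (g # gs) =
       lin (\<lambda>(c, m'). lin (\<lambda>(c', m''). lin (\<lambda>p. basis_vec (p, m'')) (mul A' c c'))
         (word_act A' l step m' gs)) (step m g)"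

datatype gen2 = Gen_e1 | Gen_e2

datatype gen11 = Gen_U1 | Gen_U2

datatype genL = Gen_x | Gen_y | Gen_z

datatype genY = Gen_a | Gen_b | Gen_c | Gen_d

fun lid_L :: "genL \<Rightarrow> obj11"
  where "lid_L Gen_x = Obj_ou" | "lid_L Gen_y = Obj_uo" | "lid_L Gen_z = Obj_oo"

fun rid_L :: "genL \<Rightarrow> obj2"
  where "rid_L Gen_x = Obj_u" | "rid_L Gen_y = Obj_u" | "rid_L Gen_z = Obj_o"

fun step_L :: "genL \<Rightarrow> gen2 \<Rightarrow> (mon11 \<times> genL) \<Rightarrow>\<^sub>0 bit"
  where
    "step_L Gen_x Gen_e1 = basis_vec (M_ou 1, Gen_x)"
  | "step_L Gen_y Gen_e1 = basis_vec (M_uo 1, Gen_y)"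
  | "step_L Gen_z Gen_e1 = basis_vec (M_oo 1 0, Gen_z) + basis_vec (M_oo 0 1, Gen_z)"
  | "step_L Gen_z Gen_e2 = basis_vec (M_oo 1 1, Gen_z)"
  | "step_L _ _ = 0"

fun word_mon2 :: "mon2 \<Rightarrow> gen2 list"
  where
    "word_mon2 (Mon_u i) = replicate i Gen_e1"
  | "word_mon2 (Mon_o i j) = replicate i Gen_e1 @ replicate j Gen_e2"

fun op_L :: "genL \<Rightarrow> mon2 list \<Rightarrow> (mon11 \<times> genL) \<Rightarrow>\<^sub>0 bit"
  where
    "op_L m [] = (if m = Gen_y then basis_vec (Lam, Gen_x) else 0)"
  | "op_L m [a] = (if obj_mon2 a = rid_L m then word_act A11 lid_L step_L m (word_mon2 a) else 0)"
  | "op_L m (a # a' # as) = 0"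

definition Lambda_bim :: "(obj11, obj2, mon11, mon2, genL) da"
  where "Lambda_bim =
    \<lparr> gens = UNIV, lid = lid_L, rid = rid_L,
      qdeg = (\<lambda>m. case m of Gen_x \<Rightarrow> -1 | Gen_y \<Rightarrow> 0 | Gen_z \<Rightarrow> 0),
      hdeg = (\<lambda>m. case m of Gen_x \<Rightarrow> 1 | Gen_y \<Rightarrow> 0 | Gen_z \<Rightarrow> 0),
      da_op = op_L \<rparr>"

fun lid_Y :: "genY \<Rightarrow> obj2"
  where "lid_Y Gen_a = Obj_u" | "lid_Y Gen_b = Obj_u" | "lid_Y Gen_c = Obj_o" | "lid_Y Gen_d = Obj_o"

fun rid_Y :: "genY \<Rightarrow> obj11"
  where "rid_Y Gen_a = Obj_ou" | "rid_Y Gen_b = Obj_uo" | "rid_Y Gen_c = Obj_oo" | "rid_Y Gen_d = Obj_oo"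

fun step_Y :: "genY \<Rightarrow> gen11 \<Rightarrow> (mon2 \<times> genY) \<Rightarrow>\<^sub>0 bit"
  where
    "step_Y Gen_c Gen_U1 = basis_vec (Mon_o 1 0, Gen_c) + basis_vec (Mon_o 0 1, Gen_d)"
  | "step_Y Gen_d Gen_U1 = basis_vec (Mon_o 0 0, Gen_c)"
  | "step_Y Gen_c Gen_U2 = basis_vec (Mon_o 0 1, Gen_d)"
  | "step_Y Gen_d Gen_U2 = basis_vec (Mon_o 0 0, Gen_c) + basis_vec (Mon_o 1 0, Gen_d)"
  | "step_Y _ _ = 0"

text \<open>The exponent \<open>k = 0\<close> in \<open>[M_ou k]\<close>, \<open>[M_uo k]\<close> is the action of an identity.\<close>

fun op_Y_a :: "mon11 list \<Rightarrow> (mon2 \<times> genY) \<Rightarrow>\<^sub>0 bit"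
  where
    "op_Y_a [M_ou k] = basis_vec (Mon_u k, Gen_a)"
  | "op_Y_a _ = 0"

fun op_Y_b :: "mon11 list \<Rightarrow> (mon2 \<times> genY) \<Rightarrow>\<^sub>0 bit"
  where
    "op_Y_b [M_uo k] = basis_vec (Mon_u k, Gen_b)"
  | "op_Y_b [Lam, M_ou (Suc k)] = basis_vec (Mon_u k, Gen_a)"
  | "op_Y_b [M_uo (Suc k), Lam] = basis_vec (Mon_u k, Gen_a)"
  | "op_Y_b _ = 0"

fun op_Y_cd :: "genY \<Rightarrow> mon11 list \<Rightarrow> (mon2 \<times> genY) \<Rightarrow>\<^sub>0 bit"
  where
    "op_Y_cd m [M_oo i j] =
       word_act A2 lid_Y step_Y m (replicate i Gen_U1 @ replicate j Gen_U2)"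
  | "op_Y_cd m _ = 0"

fun op_Y :: "genY \<Rightarrow> mon11 list \<Rightarrow> (mon2 \<times> genY) \<Rightarrow>\<^sub>0 bit"
  where
    "op_Y Gen_a as = op_Y_a as"
  | "op_Y Gen_b as = op_Y_b as"
  | "op_Y Gen_c as = op_Y_cd Gen_c as"
  | "op_Y Gen_d as = op_Y_cd Gen_d as"

definition Y_bim :: "(obj2, obj11, mon2, mon11, genY) da"
  where "Y_bim =
    \<lparr> gens = UNIV, lid = lid_Y, rid = rid_Y,
      qdeg = (\<lambda>m. case m of Gen_a \<Rightarrow> 0 | Gen_b \<Rightarrow> 1 | Gen_c \<Rightarrow> -1 | Gen_d \<Rightarrow> 1),
      hdeg = (\<lambda>m. case m of Gen_a \<Rightarrow> 1 | Gen_b \<Rightarrow> 0 | Gen_c \<Rightarrow> 2 | Gen_d \<Rightarrow> 0),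
      da_op = op_Y \<rparr>"

definition X_bim :: "(obj11, obj11, mon11, mon11, genL \<times> genY) da"
  where "X_bim = da_box Lambda_bim Y_bim"

definition X_dual :: "(obj11, obj11, mon11, mon11, genY \<times> genL) ad"
  where "X_dual = ad_box (left_dual Y_bim) (left_dual Lambda_bim)"


section \<open>Decategorification\<close>

type_synonym Cq = "complex poly fract"

definition q :: Cq
  where "q = Fract [:0, 1:] 1"

text \<open>\<open>G\<^sub>0(A)\<close> is \<^typ>\<open>Cq ^ 'o\<close> for \<^typ>\<open>'o\<close> the objects of \<open>A\<close>, with \<open>[S\<^sub>s] = axis s 1\<close>.\<close>

definition decat :: "('l::finite, 'r::finite, 'b, 'z) ibimod_scheme \<Rightarrow> Cq ^ 'r \<Rightarrow> Cq ^ 'l"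
  where "decat N v =
    (\<chi> s' s. \<Sum>n\<in>{n \<in> gens N. lid N n = s' \<and> rid N n = s}.
       (- 1) powi hdeg N n * q powi qdeg N n) *v v"


section \<open>Representations of \<open>U\<^sub>q(gl(1|1))\<close>\<close>

definition lin_ext :: "('b::finite \<Rightarrow> Cq ^ 'c) \<Rightarrow> Cq ^ 'b \<Rightarrow> Cq ^ 'c"
  where "lin_ext f v = (\<Sum>b\<in>UNIV. v $ b *s f b)"

text \<open>\<open>V0\<close>, \<open>V1\<close> index \<open>|0\<rangle>\<close>, \<open>|1\<rangle>\<close>; \<open>W01\<close>, \<open>W11\<close> index \<open>|0\<rangle> \<and> |1\<rangle>\<close>, \<open>|1\<rangle> \<and> |1\<rangle>\<close>.
  Thus \<open>V = Cq ^ vbasis\<close>, \<open>V \<otimes> V = Cq ^ (vbasis \<times> vbasis)\<close> and \<open>\<and>\<^sub>q\<^sup>2 V = Cq ^ wbasis\<close>.\<close>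

datatype vbasis = V0 | V1

datatype wbasis = W01 | W11

instance vbasis :: finite
proof
  have "(UNIV :: vbasis set) = {V0, V1}"
    using vbasis.exhaust by auto
  then show "finite (UNIV :: vbasis set)"
    by (metis finite.emptyI finite_insert)
qed

instance wbasis :: finite
proof
  have "(UNIV :: wbasis set) = {W01, W11}"
    using wbasis.exhaust by auto
  then show "finite (UNIV :: wbasis set)"
    by (metis finite.emptyI finite_insert)
qed

definition V_E :: "Cq ^ vbasis \<Rightarrow> Cq ^ vbasis"
  where "V_E = lin_ext (\<lambda>b. case b of V0 \<Rightarrow> 0 | V1 \<Rightarrow> axis V0 1)"

definition V_F :: "Cq ^ vbasis \<Rightarrow> Cq ^ vbasis"
  where "V_F = lin_ext (\<lambda>b. case b of V0 \<Rightarrow> axis V1 1 | V1 \<Rightarrow> 0)"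

text \<open>\<open>V_H1 n\<close> and \<open>V_H2 n\<close> are the actions of the \<open>n\<close>-th powers of \<open>q\<^sup>H\<^sup>1\<close> and \<open>q\<^sup>H\<^sup>2\<close>.\<close>

definition V_H1 :: "int \<Rightarrow> Cq ^ vbasis \<Rightarrow> Cq ^ vbasis"
  where "V_H1 n = lin_ext (\<lambda>b. case b of V0 \<Rightarrow> (q powi n) *s axis V0 1 | V1 \<Rightarrow> axis V1 1)"

definition V_H2 :: "int \<Rightarrow> Cq ^ vbasis \<Rightarrow> Cq ^ vbasis"
  where "V_H2 n = lin_ext (\<lambda>b. case b of V0 \<Rightarrow> axis V0 1 | V1 \<Rightarrow> (q powi n) *s axis V1 1)"

definition tensor_vec :: "Cq ^ vbasis \<Rightarrow> Cq ^ vbasis \<Rightarrow> Cq ^ (vbasis \<times> vbasis)"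
  where "tensor_vec v w = (\<chi> p. v $ fst p * w $ snd p)"

text \<open>The tensor product \<open>f \<otimes> g\<close> of operators on \<open>V\<close>, with the super sign rule
  \<open>(f \<otimes> g)(v \<otimes> w) = (-1)\<^sup>|\<^sup>g\<^sup>|\<^sup>|\<^sup>v\<^sup>| f v \<otimes> g w\<close>; the flag says whether \<open>g\<close> is odd.\<close>

definition tensor_op :: "(Cq ^ vbasis \<Rightarrow> Cq ^ vbasis) \<Rightarrow> bool \<Rightarrow> (Cq ^ vbasis \<Rightarrow> Cq ^ vbasis) \<Rightarrow>
    Cq ^ (vbasis \<times> vbasis) \<Rightarrow> Cq ^ (vbasis \<times> vbasis)"
  where "tensor_op f g_odd g = lin_ext (\<lambda>(i, j).
    (if g_odd \<and> i = V1 then - 1 else 1) *s tensor_vec (f (axis i 1)) (g (axis j 1)))"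

definition VV_E :: "Cq ^ (vbasis \<times> vbasis) \<Rightarrow> Cq ^ (vbasis \<times> vbasis)"
  where "VV_E w = tensor_op V_E False (V_H1 (-1) \<circ> V_H2 (-1)) w + tensor_op id True V_E w"

definition VV_F :: "Cq ^ (vbasis \<times> vbasis) \<Rightarrow> Cq ^ (vbasis \<times> vbasis)"
  where "VV_F w = tensor_op V_F False id w + tensor_op (V_H1 1 \<circ> V_H2 1) True V_F w"

definition VV_H1 :: "int \<Rightarrow> Cq ^ (vbasis \<times> vbasis) \<Rightarrow> Cq ^ (vbasis \<times> vbasis)"
  where "VV_H1 n = tensor_op (V_H1 n) False (V_H1 n)"

definition VV_H2 :: "int \<Rightarrow> Cq ^ (vbasis \<times> vbasis) \<Rightarrow> Cq ^ (vbasis \<times> vbasis)"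
  where "VV_H2 n = tensor_op (V_H2 n) False (V_H2 n)"

definition intertwiner :: "(Cq ^ (vbasis \<times> vbasis) \<Rightarrow> Cq ^ (vbasis \<times> vbasis)) \<Rightarrow> bool"
  where "intertwiner T \<longleftrightarrow>
    Vector_Spaces.linear (*s) (*s) T \<and>
    (\<forall>g\<in>{VV_E, VV_F, VV_H1 1, VV_H1 (-1), VV_H2 1, VV_H2 (-1)}. T \<circ> g = g \<circ> T)"

definition howe_E :: "Cq ^ (vbasis \<times> vbasis) \<Rightarrow> Cq ^ wbasis"
  where "howe_E = lin_ext (\<lambda>p. case p of
      (V0, V0) \<Rightarrow> 0
    | (V1, V0) \<Rightarrow> (- q) *s axis W01 1
    | (V0, V1) \<Rightarrow> axis W01 1
    | (V1, V1) \<Rightarrow> axis W11 1)"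

definition howe_F :: "Cq ^ wbasis \<Rightarrow> Cq ^ (vbasis \<times> vbasis)"
  where "howe_F = lin_ext (\<lambda>w. case w of
      W01 \<Rightarrow> - axis (V1, V0) 1 + inverse q *s axis (V0, V1) 1
    | W11 \<Rightarrow> (q + inverse q) *s axis (V1, V1) 1)"

definition singular_crossing :: "Cq ^ (vbasis \<times> vbasis) \<Rightarrow> Cq ^ (vbasis \<times> vbasis)"
  where "singular_crossing = howe_F \<circ> howe_E"

fun ket :: "obj11 \<Rightarrow> vbasis \<times> vbasis"
  where
    "ket Obj_uu = (V0, V0)"
  | "ket Obj_ou = (V1, V0)"
  | "ket Obj_uo = (V0, V1)"
  | "ket Obj_oo = (V1, V1)"

text \<open>The identification of \<open>G\<^sub>0\<close> with \<open>V \<otimes> V\<close>.\<close>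

definition G0_to_VV :: "Cq ^ obj11 \<Rightarrow> Cq ^ (vbasis \<times> vbasis)"
  where "G0_to_VV = lin_ext (\<lambda>s. axis (ket s) 1)"

definition categorifies ::
    "(obj11, obj11, 'b, 'z) ibimod_scheme \<Rightarrow> (Cq ^ (vbasis \<times> vbasis) \<Rightarrow> Cq ^ (vbasis \<times> vbasis)) \<Rightarrow> bool"
  where "categorifies N T \<longleftrightarrow> (\<forall>v. G0_to_VV (decat N v) = T (G0_to_VV v))"

end

theory Submission
  imports Defs
begin

text \<open>
  The structure relation of a DA bimodule says that composing operations and multiplying their
  outputs cancels against multiplying adjacent inputs and against the differentials.  It is handled
  through \<open>post f v\<close>: apply the operation \<open>f\<close> after the partial result \<open>v\<close> and multiply the outputs.
  Because multiplication in a dg category is associative, \<open>post\<close> is associative (\<open>post_assoc\<close>).  Hence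
  a right action given by words in generators is multiplicative (\<open>word_act_append\<close>), and it depends
  only on the monomial when the generators commute (\<open>word_act_normal_form\<close>).

  This settles the relation wherever there is only an action: on \<open>\<Lambda>\<close>, up to the compatibility
  \<open>(\<partial>m) \<cdot> a = \<partial>(m \<cdot> a)\<close> with the differential, and at the basis elements \<open>a\<close>, \<open>c\<close>, \<open>d\<close> of \<open>Y\<close>.  At \<open>b\<close>
  the operations with three or more inputs vanish, hence so does the relation with five or more
  inputs, and the shorter cases are checked one by one.

  Three general facts then carry the argument.  First, the left dual of a finitely generated DA
  bimodule is an AD bimodule (\<open>ad_bimodule_left_dual\<close>), because the relation of the dual is the
  transpose of the relation of the bimodule.  Second, if \<open>M\<close> has only a differential and an action,
  then \<open>M \<boxtimes> N\<close> is a DA bimodule (\<open>da_bimodule_box\<close>): an operation on \<open>m \<boxtimes> n\<close> is either the differential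
  of \<open>m\<close> or an operation of \<open>N\<close> whose output acts on \<open>m\<close>, so its relation follows from the relation of
  \<open>N\<close>, the associativity of the action on \<open>M\<close>, and the Leibniz rule of \<open>M\<close>.  Third, for such \<open>M\<close> the
  box tensor product of the duals in the opposite order is the dual of the box tensor product
  (\<open>ad_op_left_dual_box\<close>), and being an AD bimodule transfers along such an identification
  (\<open>ad_bimodule_transfer\<close>).  The operations of \<open>\<Lambda>\<close> and \<open>Y\<close> vanish on inputs that do not match
  (\<open>supported\<close>), which the first two facts and the identification in the third require.

  The decategorified map is read off the six basis elements of the dual bimodule, and the
  intertwining property is a computation in the four basis vectors of \<open>V \<otimes> V\<close>.
\<close>

section \<open>Linear extension over the field with two elements\<close>

lemma add_self_bit [simp]: "v + v = (0 :: 'b \<Rightarrow>\<^sub>0 bit)"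
  by (rule poly_mapping_eqI) (simp add: lookup_add)

lemma keys_add_bit:
  fixes v w :: "'b \<Rightarrow>\<^sub>0 bit"
  shows "b \<in> Poly_Mapping.keys (v + w) \<longleftrightarrow> (b \<in> Poly_Mapping.keys v) \<noteq> (b \<in> Poly_Mapping.keys w)"
  by (cases "Poly_Mapping.lookup v b = 0"; cases "Poly_Mapping.lookup w b = 0") (auto simp:
      in_keys_iff lookup_add)

lemma add_eq_zero_bit: "v + w = 0 \<longleftrightarrow> v = w" for v w :: "'b \<Rightarrow>\<^sub>0 bit"
  by (metis add_self_bit add_eq_0_iff2 minus_unique)

lemma lin_zero [simp]: "lin f 0 = 0"
  by (simp add: lin_def)

lemma lin_fun_zero [simp]: "lin (\<lambda>_. 0) v = 0"
  by (simp add: lin_def)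

lemma lin_basis_vec [simp]: "lin f (basis_vec b) = f b"
  by (simp add: lin_def)

lemma lin_superset:
  assumes "finite S" "Poly_Mapping.keys v \<subseteq> S"
  shows "lin f v = (\<Sum>b\<in>S. if b \<in> Poly_Mapping.keys v then f b else 0)"
proof -
  have "(\<Sum>b\<in>S. if b \<in> Poly_Mapping.keys v then f b else 0) = sum f (S \<inter> Poly_Mapping.keys v)"
    using assms(1) by (rule sum.inter_restrict[symmetric])
  also have "S \<inter> Poly_Mapping.keys v = Poly_Mapping.keys v"
    using assms(2) by blast
  finally show ?thesis
    by (simp add: lin_def)
qed

text \<open>Additivity holds because basis vectors in both supports contribute twice and cancel.\<close>

lemma lin_add [simp]: "lin f (v + w) = lin f v + lin f w"
proof -
  let ?S = "Poly_Mapping.keys v \<union> Poly_Mapping.keys w"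
  have "lin f (v + w) = (\<Sum>b\<in>?S. if b \<in> Poly_Mapping.keys (v + w) then f b else 0)"
    by (intro lin_superset) (auto simp: keys_add_bit)
  also have "\<dots> = (\<Sum>b\<in>?S. (if b \<in> Poly_Mapping.keys v then f b else 0)
                       + (if b \<in> Poly_Mapping.keys w then f b else 0))"
    by (intro sum.cong) (auto simp: keys_add_bit)
  also have "\<dots> = lin f v + lin f w"
    by (simp add: sum.distrib lin_superset[of ?S])
  finally show ?thesis .
qed

lemma lin_sum: "lin f (\<Sum>i\<in>I. g i) = (\<Sum>i\<in>I. lin f (g i))"
  by (induction I rule: infinite_finite_induct) auto

lemma lin_fun_add: "lin (\<lambda>b. f b + g b) v = lin f v + lin g v"
  by (simp add: lin_def sum.distrib)

lemma lin_fun_sum: "lin (\<lambda>b. \<Sum>i\<in>I. f i b) v = (\<Sum>i\<in>I. lin (f i) v)"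
  unfolding lin_def by (rule sum.swap)

lemma lin_lin: "lin f (lin g v) = lin (\<lambda>b. lin f (g b)) v"
  by (simp add: lin_def[of g] lin_def[of "\<lambda>b. lin f (g b)"] lin_sum)

lemma lin_swap: "lin (\<lambda>a. lin (h a) w) v = lin (\<lambda>b. lin (\<lambda>a. h a b) v) w"
  unfolding lin_def by (rule sum.swap)

lemma lin_cong:
  assumes "\<And>b. b \<in> Poly_Mapping.keys v \<Longrightarrow> f b = g b"
  shows "lin f v = lin g v"
  using assms by (simp add: lin_def)

lemma lin_cong2:
  assumes "\<And>b c. (b, c) \<in> Poly_Mapping.keys v \<Longrightarrow> f b c = g b c"
  shows "lin (\<lambda>(b, c). f b c) v = lin (\<lambda>(b, c). g b c) v"
  using assms by (auto intro: lin_cong)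

lemma lin_id [simp]: "lin basis_vec v = v"
proof (rule poly_mapping_eqI)
  fix c
  have "Poly_Mapping.lookup (lin basis_vec v) c = (\<Sum>b\<in>Poly_Mapping.keys v. Poly_Mapping.lookup
      (basis_vec b) c)"
    by (simp add: lin_def lookup_sum)
  also have "\<dots> = (if c \<in> Poly_Mapping.keys v then 1 else 0)"
    by (simp add: lookup_single when_def)
  also have "\<dots> = Poly_Mapping.lookup v c"
    by (auto simp: in_keys_iff)
  finally show "Poly_Mapping.lookup (lin basis_vec v) c = Poly_Mapping.lookup v c" .
qed

lemma lin_id_pair [simp]: "lin (\<lambda>(a, b). basis_vec (a, b)) v = v"
  using lin_id[of v] by (simp add: case_prod_beta')

lemma keys_lin: "c \<in> Poly_Mapping.keys (lin f v) \<Longrightarrow>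
    \<exists>b\<in>Poly_Mapping.keys v. c \<in> Poly_Mapping.keys (f b)"
  unfolding lin_def using keys_sum by fastforce

lemma keys_lin_pair:
  assumes "x \<in> Poly_Mapping.keys (lin (\<lambda>(a, b). f a b) v)"
  obtains a b where "(a, b) \<in> Poly_Mapping.keys v" "x \<in> Poly_Mapping.keys (f a b)"
  using keys_lin[OF assms] by auto

section \<open>Composing operations with outputs\<close>

text \<open>
  \<open>post A f v\<close> applies \<open>f\<close> to the second tensor factor of \<open>v = \<Sum> c \<otimes> n\<close> and multiplies the output
  of \<open>f\<close> by \<open>c\<close> from the left: the composite \<open>(\<mu> \<otimes> id)(id \<otimes> f)\<close>.
\<close>

definition post :: "('l, 'c) dgcat \<Rightarrow> ('m \<Rightarrow> ('c \<times> 'n) \<Rightarrow>\<^sub>0 bit) \<Rightarrow>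
    (('c \<times> 'm) \<Rightarrow>\<^sub>0 bit) \<Rightarrow> ('c \<times> 'n) \<Rightarrow>\<^sub>0 bit"
  where "post A f v = lin (\<lambda>(c, n).
    lin (\<lambda>(c', n'). lin (\<lambda>p. basis_vec (p, n')) (mul A c c')) (f n)) v"

lemma post_zero [simp]: "post A f 0 = 0"
  by (simp add: post_def)

lemma post_add: "post A f (v + w) = post A f v + post A f w"
  by (simp add: post_def)

lemma post_fun_zero [simp]: "post A (\<lambda>_. 0) v = 0"
  by (simp add: post_def case_prod_beta')

lemma post_fun_add: "post A (\<lambda>n. f n + g n) v = post A f v + post A g v"
  by (simp add: post_def case_prod_beta' lin_fun_add)

lemma post_lin: "post A f (lin g v) = lin (\<lambda>b. post A f (g b)) v"
  by (simp add: post_def lin_lin)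

lemma post_cong:
  assumes "\<And>c n. (c, n) \<in> Poly_Mapping.keys v \<Longrightarrow> f n = g n"
  shows "post A f v = post A g v"
  unfolding post_def by (intro lin_cong2) (simp add: assms)

lemma keys_post:
  assumes "(p, n') \<in> Poly_Mapping.keys (post A f v)"
  obtains c n c' where "(c, n) \<in> Poly_Mapping.keys v" "(c', n') \<in> Poly_Mapping.keys (f n)"
    "p \<in> Poly_Mapping.keys (mul A c c')"
  using assms unfolding post_def
  by (auto dest!: keys_lin split: if_splits)

lemma word_act_Cons: "word_act A l step m (g # gs) = post A (\<lambda>n. word_act A l step n gs) (step m g)"
  by (simp add: post_def)

lemma post_basis_vec: "post A f (basis_vec (c, n)) =
    lin (\<lambda>(c', n'). lin (\<lambda>p. basis_vec (p, n')) (mul A c c')) (f n)"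
  by (simp add: post_def)

context dg_category
begin

text \<open>
  Associativity of the multiplication makes \<open>post\<close> the composition of a Kleisli category.
\<close>

lemma post_assoc: "post A f (post A g v) = post A (\<lambda>n. post A f (g n)) v"
proof -
  have "post A f (lin (\<lambda>(c', n'). lin (\<lambda>p. basis_vec (p, n')) (mul A c c')) (g n)) =
     lin (\<lambda>(p, n''). lin (\<lambda>s. basis_vec (s, n'')) (mul A c p)) (post A f (g n))" for c n
  proof -
    have "lin (\<lambda>p. lin (\<lambda>(c'', n''). lin (\<lambda>s. basis_vec (s, n'')) (mul A p c'')) (f n'))
        (mul A c c')
       = lin (\<lambda>(c'', n''). lin (\<lambda>s. basis_vec (s, n'')) (lin (mul A c) (mul A c' c'')))
           (f n')" for c' n'
      by (subst lin_swap) (simp add: mul_assoc[symmetric] lin_lin case_prod_beta')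
    then show ?thesis
      by (simp add: post_def lin_lin case_prod_beta')
  qed
  then show ?thesis
    unfolding post_def[of A g v] post_def[of A "\<lambda>n. post A f (g n)" v]
    by (simp add: post_lin case_prod_beta')
qed

lemma post_ident_left:
  assumes "\<And>c n. (c, n) \<in> Poly_Mapping.keys (f m) \<Longrightarrow> lft A c = s"
  shows "post A f (basis_vec (ident A s, m)) = f m"
proof -
  have "mul A (ident A s) c = basis_vec c" if "(c, n) \<in> Poly_Mapping.keys (f m)" for c n
    using mul_ident(1)[of c] assms[OF that] by simp
  then have "lin (\<lambda>(c', n'). lin (\<lambda>p. basis_vec (p, n')) (mul A (ident A s) c')) (f m) =
      lin (\<lambda>(c, n). basis_vec (c, n)) (f m)"
    by (intro lin_cong2) simp
  then show ?thesis
    by (simp add: post_def)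
qed

text \<open>Objects and degrees of a word action are determined letter by letter.\<close>

lemma keys_word_act:
  assumes step: "\<And>m g c n. (c, n) \<in> Poly_Mapping.keys (step m g) \<Longrightarrow>
      lft A c = l m \<and> rgt A c = l n \<and> r n = r m \<and>
      dq m + wq g = cat_q A c + dq n \<and> dh m + wh g = cat_h A c + dh n"
    and ident_deg: "\<And>s. cat_q A (ident A s) = 0 \<and> cat_h A (ident A s) = 0"
    and "(c, n) \<in> Poly_Mapping.keys (word_act A l step m gs)"
  shows "lft A c = l m \<and> rgt A c = l n \<and> r n = r m \<and>
      dq m + sum_list (map wq gs) = cat_q A c + dq n \<and> dh m + sum_list (map wh gs) = cat_h A c
          + dh n"
  using assms(3)
proof (induction gs arbitrary: m c n)
  case Nil
  then show ?case by (simp add: ident_obj ident_deg)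
next
  case (Cons g gs)
  from Cons.prems obtain c1 n1 c2 where
    1: "(c1, n1) \<in> Poly_Mapping.keys (step m g)"
      "(c2, n) \<in> Poly_Mapping.keys (word_act A l step n1 gs)" "c \<in> Poly_Mapping.keys (mul A c1 c2)"
    unfolding word_act_Cons by (elim keys_post)
  show ?case
    using step[OF 1(1)] Cons.IH[OF 1(2)] mul_obj[OF 1(3)] mul_deg[OF 1(3)] by simp
qed

lemma word_act_append:
  assumes step: "\<And>m g c n. (c, n) \<in> Poly_Mapping.keys (step m g) \<Longrightarrow> lft A c = l m \<and> rgt A c = l n"
  shows "word_act A l step m (gs @ hs) =
     post A (\<lambda>n. word_act A l step n hs) (word_act A l step m gs)"
proof (induction gs arbitrary: m)
  case Nil
  have "lft A c = l m" if "(c, n) \<in> Poly_Mapping.keys (word_act A l step m hs)" for c n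
  proof (cases hs)
    case Nil
    with that show ?thesis by (simp add: ident_obj)
  next
    case (Cons g gs)
    with that show ?thesis
      unfolding Cons word_act_Cons by (elim keys_post) (auto dest!: mul_obj step)
  qed
  then show ?case
    by (simp add: post_ident_left)
next
  case (Cons g gs)
  show ?case
    unfolding append_Cons word_act_Cons post_assoc Cons.IH ..
qed

text \<open>Generators whose actions commute can be sorted past each other.\<close>

lemma word_act_swap:
  assumes comm: "\<And>m. post A (\<lambda>n. step n h) (step m g) = post A (\<lambda>n. step n g) (step m h)"
  shows "word_act A l step m (replicate j h @ replicate i g @ gs) =
     word_act A l step m (replicate i g @ replicate j h @ gs)"
proof -
  have two: "word_act A l step m (g # h # gs) = word_act A l step m (h # g # gs)" for m gs
    unfolding word_act_Cons post_assoc[symmetric] comm ..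
  have one: "word_act A l step m (g # replicate j h @ gs) = word_act A l step m (replicate j h @ g
      # gs)" for m gs
  proof (induction j arbitrary: m)
    case (Suc j)
    then show ?case
      using two[of m "replicate j h @ gs"] by (simp add: word_act_Cons)
  qed simp
  show ?thesis
  proof (induction i arbitrary: m)
    case (Suc i)
    have "word_act A l step m (replicate j h @ replicate (Suc i) g @ gs)
       = word_act A l step m (g # replicate j h @ replicate i g @ gs)"
      using one[of m "replicate i g @ gs"] by simp
    also have "\<dots> = word_act A l step m (g # replicate i g @ replicate j h @ gs)"
      unfolding word_act_Cons Suc ..
    finally show ?case by simp
  qed simp
qed

end

text \<open>
  If the actions of two generators commute, the action of the monomials \<open>g\<^sup>i h\<^sup>j\<close> is multiplicative.
\<close>

lemma (in dg_category) word_act_normal_form: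
  assumes step: "\<And>m g c n. (c, n) \<in> Poly_Mapping.keys (step m g) \<Longrightarrow> lft A c = l m \<and> rgt A c = l n"
    and comm: "\<And>m. post A (\<lambda>n. step n h) (step m g) = post A (\<lambda>n. step n g) (step m h)"
  shows "post A (\<lambda>n. word_act A l step n (replicate i' g @ replicate j' h))
      (word_act A l step m (replicate i g @ replicate j h)) =
    word_act A l step m (replicate (i + i') g @ replicate (j + j') h)"
proof -
  have prefix: "word_act A l step m (ks @ replicate j h @ replicate i' g @ replicate j' h) =
     word_act A l step m (ks @ replicate i' g @ replicate j h @ replicate j' h)" for ks
  proof (induction ks arbitrary: m)
    case Nil
    show ?case
      using word_act_swap[OF comm] by simp
  next
    case (Cons k ks)
    show ?case
      unfolding append_Cons word_act_Cons Cons ..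
  qed
  show ?thesis
    using prefix[of "replicate i g"] by (simp add: word_act_append[OF step, symmetric]
        replicate_add)
qed

section \<open>The structure relation\<close>

text \<open>
  The left-hand side of the structure relation of a DA bimodule at \<open>m\<close> with inputs \<open>as\<close>.
\<close>

definition da_rel ::
    "('l, 'c) dgcat \<Rightarrow> ('r, 'a) dgcat \<Rightarrow> ('l, 'r, 'c, 'a, 'b) da \<Rightarrow> 'b \<Rightarrow> 'a list \<Rightarrow> ('c \<times> 'b) \<Rightarrow>\<^sub>0 bit"
  where "da_rel A' A M m as =
    (\<Sum>k\<le>length as. post A' (\<lambda>n. da_op M n (drop k as)) (da_op M m (take k as)))
    + (\<Sum>j<length as. lin (\<lambda>a. da_op M m (as[j := a])) (dif A (as ! j)))
    + (\<Sum>j<length as - 1.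
         lin (\<lambda>a. da_op M m (take j as @ a # drop (j + 2) as)) (mul A (as ! j) (as ! (j + 1))))
    + lin (\<lambda>(c, n). lin (\<lambda>p. basis_vec (p, n)) (dif A' c)) (da_op M m as)"

lemma (in da_bimodule) da_rel_zero:
  "\<lbrakk>m \<in> gens M; path A (rid M m) as t\<rbrakk> \<Longrightarrow> da_rel A' A M m as = 0"
  using relation[of m as t] unfolding da_rel_def post_def .

lemma da_bimoduleI:
  fixes A' :: "('l::finite, 'c) dgcat" and A :: "('r::finite, 'a) dgcat"
  assumes "dg_category A'" "dg_category A"
    and "\<And>m as t c n. \<lbrakk>m \<in> gens M; path A (rid M m) as t; (c, n) \<in> Poly_Mapping.keys
        (da_op M m as)\<rbrakk> \<Longrightarrow>
        n \<in> gens M \<and> lft A' c = lid M m \<and> rgt A' c = lid M n \<and> rid M n = t"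
    and "\<And>m as t c n. \<lbrakk>m \<in> gens M; path A (rid M m) as t; (c, n) \<in> Poly_Mapping.keys
        (da_op M m as)\<rbrakk> \<Longrightarrow>
        qdeg M m + inputs_q A as = cat_q A' c + qdeg M n \<and>
        hdeg M m + inputs_h A as = (cat_h A' c - 1) + hdeg M n"
    and "\<And>m as t. \<lbrakk>m \<in> gens M; path A (rid M m) as t\<rbrakk> \<Longrightarrow> da_rel A' A M m as = 0"
    and "\<And>m. m \<in> gens M \<Longrightarrow> da_op M m [ident A (rid M m)] = basis_vec (ident A' (lid M m), m)"
    and "\<And>m as t s. \<lbrakk>m \<in> gens M; path A (rid M m) as t; length as > 1; ident A s \<in> set as\<rbrakk> \<Longrightarrow>
        da_op M m as = 0"
  shows "da_bimodule A' A M"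
  using assms unfolding da_rel_def post_def
  by (intro da_bimodule.intro da_bimodule_axioms.intro) blast+

text \<open>
  Operations on inputs that do not match are meaningless in a DA bimodule, but the left dual and the
  box tensor product range over all basis elements and all inputs.  A DA bimodule is \<open>supported\<close> if
  its operations vanish on inputs that do not start at the right object of the basis element, or do
  not match each other.
\<close>

definition supported :: "('r, 'a) dgcat \<Rightarrow> ('l, 'r, 'c, 'a, 'b) da \<Rightarrow> bool"
  where "supported A M \<longleftrightarrow>
    (\<forall>m\<in>gens M. \<forall>as. da_op M m as \<noteq> 0 \<longrightarrow> (\<exists>t. path A (rid M m) as t))"

lemma path_unique: "path A s as t \<Longrightarrow> path A s as t' \<Longrightarrow> t = t'"
  by (induction as arbitrary: s) auto

lemma path_take: "path A s as t \<Longrightarrow> \<exists>r. path A s (take k as) r \<and> path A r (drop k as) t"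
proof (induction as arbitrary: s k)
  case (Cons a as)
  then show ?case
    by (cases k) auto
qed auto

lemma path_append: "path A s (as @ bs) t \<longleftrightarrow> (\<exists>r. path A s as r \<and> path A r bs t)"
  by (induction as arbitrary: s) auto

lemma (in dg_category) path_update:
  assumes "path A s as t" "j < length as" "a \<in> Poly_Mapping.keys (dif A (as ! j))"
  shows "path A s (as[j := a]) t"
  using assms
proof (induction as arbitrary: s j)
  case (Cons b as)
  then show ?case
    by (cases j) (auto dest: dif_obj)
qed simp

lemma (in dg_category) path_merge:
  assumes "path A s as t" "j < length as - 1"
      "a \<in> Poly_Mapping.keys (mul A (as ! j) (as ! (j + 1)))"
  shows "path A s (take j as @ a # drop (j + 2) as) t"
  using assms
proof (induction as arbitrary: s j)
  case (Cons b as)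
  show ?case
  proof (cases j)
    case 0
    then obtain b' as' where "as = b' # as'"
      using Cons.prems(2) by (cases as) auto
    with Cons.prems 0 show ?thesis
      by (auto dest: mul_obj)
  next
    case (Suc i)
    with Cons.prems Cons.IH[of "rgt A b" i] show ?thesis
      by auto
  qed
qed simp

text \<open>
  If operations with at least \<open>r\<close> inputs vanish at \<open>m\<close> and at all basis elements reached from it,
  then so does the relation at \<open>m\<close> for at least \<open>2 r - 1\<close> inputs: one of the two factors of a split
  then has at least \<open>r\<close> inputs, and merging two inputs leaves at least \<open>r\<close> of them.
\<close>

lemma da_rel_long:
  assumes "r \<ge> 2" and long: "\<And>n bs. n \<in> S \<Longrightarrow> length bs \<ge> r \<Longrightarrow> da_op M n bs = 0"
    and m: "m \<in> S" and closed: "\<And>c n bs. (c, n) \<in> Poly_Mapping.keys (da_op M m bs) \<Longrightarrow> n \<in> S"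
    and as: "length as \<ge> 2 * r - 1"
  shows "da_rel A' A M m as = 0"
proof -
  have "post A' (\<lambda>n. da_op M n (drop k as)) (da_op M m (take k as)) = 0" if "k \<le> length as" for k
  proof (cases "k \<ge> r")
    case True
    with that have "da_op M m (take k as) = 0"
      by (intro long m) simp
    then show ?thesis by simp
  next
    case False
    with as \<open>r \<ge> 2\<close> have "length (drop k as) \<ge> r"
      by simp
    then have "post A' (\<lambda>n. da_op M n (drop k as)) (da_op M m (take k as)) = post A' (\<lambda>n. 0)
        (da_op M m (take k as))"
      by (intro post_cong long) (use closed in blast)
    then show ?thesis by simp
  qed
  moreover have "da_op M m (as[j := a]) = 0" "da_op M m as = 0" for j a
    using as \<open>r \<ge> 2\<close> by (auto intro!: long m)
  moreover have "da_op M m (take j as @ a # drop (j + 2) as) = 0" if "j < length as - 1" for j a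
    using that as \<open>r \<ge> 2\<close> by (intro long m) simp
  ultimately show ?thesis
    by (simp add: da_rel_def)
qed

lemma short_list_cases:
  obtains "as = []" | a where "as = [a]" | a b where "as = [a, b]" | "length as \<ge> 3"
proof (cases as)
  case (Cons a bs)
  with that show thesis
    by (cases bs; cases "tl bs") auto
qed (use that in simp)

section \<open>Left duals\<close>

text \<open>
  The coefficient, with values in the algebra, of the basis element \<open>m\<close> in \<open>v = \<Sum> c \<otimes> n\<close>.
\<close>

definition comp_at :: "'b \<Rightarrow> (('c \<times> 'b) \<Rightarrow>\<^sub>0 bit) \<Rightarrow> 'c \<Rightarrow>\<^sub>0 bit"
  where "comp_at m v = lin (\<lambda>(c, n). if n = m then basis_vec c else 0) v"

text \<open>The map \<open>c \<mapsto> m \<otimes> c\<close>.\<close>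

definition tag :: "'b \<Rightarrow> ('c \<Rightarrow>\<^sub>0 bit) \<Rightarrow> ('b \<times> 'c) \<Rightarrow>\<^sub>0 bit"
  where "tag m v = lin (\<lambda>c. basis_vec (m, c)) v"

lemma comp_at_zero [simp]: "comp_at m 0 = 0"
  by (simp add: comp_at_def)

lemma comp_at_add: "comp_at m (v + w) = comp_at m v + comp_at m w"
  by (simp add: comp_at_def)

lemma comp_at_sum: "comp_at m (\<Sum>i\<in>I. f i) = (\<Sum>i\<in>I. comp_at m (f i))"
  by (simp add: comp_at_def lin_sum)

lemma comp_at_lin: "comp_at m (lin f v) = lin (\<lambda>b. comp_at m (f b)) v"
  by (simp add: comp_at_def lin_lin)

lemma tag_zero [simp]: "tag m 0 = 0"
  by (simp add: tag_def)

lemma tag_add: "tag m (v + w) = tag m v + tag m w"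
  by (simp add: tag_def)

lemma tag_sum: "tag m (\<Sum>i\<in>I. f i) = (\<Sum>i\<in>I. tag m (f i))"
  by (simp add: tag_def lin_sum)

lemma tag_lin: "tag m (lin f v) = lin (\<lambda>b. tag m (f b)) v"
  by (simp add: tag_def lin_lin)

lemma lin_tag: "lin f (tag m v) = lin (\<lambda>c. f (m, c)) v"
  by (simp add: tag_def lin_lin)

lemma keys_comp_at: "c \<in> Poly_Mapping.keys (comp_at m v) \<Longrightarrow> (c, m) \<in> Poly_Mapping.keys v"
  unfolding comp_at_def by (auto dest!: keys_lin split: if_splits)

lemma keys_tag: "(n, c) \<in> Poly_Mapping.keys (tag m v) \<Longrightarrow> n = m \<and> c \<in> Poly_Mapping.keys v"
  unfolding tag_def by (auto dest!: keys_lin)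

text \<open>
  The operation of the dual on \<open>m\<^sup>*\<close> collects the \<open>m\<close>-coefficients of all operations.
\<close>

lemma ad_op_left_dual: "ad_op (left_dual M) as m = (\<Sum>n\<in>gens M. tag n (comp_at m (da_op M n as)))"
  by (simp add: left_dual_def tag_def comp_at_def lin_lin case_prod_beta' if_distrib cong: if_cong)

lemma left_dual_sel [simp]:
  "gens (left_dual M) = gens M" "lid (left_dual M) = rid M" "rid (left_dual M) = lid M"
  "qdeg (left_dual M) n = - qdeg M n" "hdeg (left_dual M) n = - hdeg M n"
  by (simp_all add: left_dual_def)

lemma comp_decompose:
  assumes "finite G" "\<And>c n. (c, n) \<in> Poly_Mapping.keys v \<Longrightarrow> n \<in> G"
  shows "lin (\<lambda>(c, n). f c n) v = (\<Sum>n\<in>G. lin (\<lambda>c. f c n) (comp_at n v))"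
proof -
  have "(\<Sum>n\<in>G. lin (\<lambda>c. f c n) (comp_at n v)) =
      lin (\<lambda>(c, n'). \<Sum>n\<in>G. if n' = n then f c n else 0) v"
    by (simp add: comp_at_def lin_lin lin_fun_sum[symmetric] case_prod_beta' if_distrib[of "lin _"]
        cong: if_cong)
  also have "\<dots> = lin (\<lambda>(c, n). f c n) v"
    by (intro lin_cong2) (use assms in simp)
  finally show ?thesis ..
qed

lemma keys_ad_op_left_dual:
  assumes "(n, c) \<in> Poly_Mapping.keys (ad_op (left_dual M) as m)"
  shows "n \<in> gens M" "(c, m) \<in> Poly_Mapping.keys (da_op M n as)"
proof -
  obtain n' where "n' \<in> gens M" "(n, c) \<in> Poly_Mapping.keys (tag n' (comp_at m (da_op M n' as)))"
    using assms keys_sum unfolding ad_op_left_dual by fastforce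
  then show "n \<in> gens M" "(c, m) \<in> Poly_Mapping.keys (da_op M n as)"
    by (auto dest!: keys_tag keys_comp_at)
qed

text \<open>The left-hand side of the structure relation of an AD bimodule.\<close>

definition ad_rel ::
    "('l, 'c) dgcat \<Rightarrow> ('r, 'a) dgcat \<Rightarrow> ('l, 'r, 'c, 'a, 'b) ad \<Rightarrow> 'c list \<Rightarrow> 'b \<Rightarrow> ('b \<times> 'a) \<Rightarrow>\<^sub>0 bit"
  where "ad_rel A' A N cs m =
    (\<Sum>k\<le>length cs.
       lin (\<lambda>(n, a).
         lin (\<lambda>(n', a'). lin (\<lambda>p. basis_vec (n', p)) (mul A a' a)) (ad_op N (take k cs) n))
       (ad_op N (drop k cs) m))
    + (\<Sum>j<length cs. lin (\<lambda>c. ad_op N (cs[j := c]) m) (dif A' (cs ! j)))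
    + (\<Sum>j<length cs - 1.
         lin (\<lambda>c. ad_op N (take j cs @ c # drop (j + 2) cs) m) (mul A' (cs ! j) (cs ! (j + 1))))
    + lin (\<lambda>(n, a). lin (\<lambda>p. basis_vec (n, p)) (dif A a)) (ad_op N cs m)"

context da_bimodule
begin

text \<open>Empty input lists must be excluded here: they match every object.\<close>

lemma da_op_off_path:
  assumes "supported A M" "m \<in> gens M" "path A s as t" "s \<noteq> rid M m" "as \<noteq> []"
  shows "da_op M m as = 0"
  using assms unfolding supported_def by (cases as) fastforce+

lemma op_closed:
  assumes "supported A M" "m \<in> gens M" "(c, n) \<in> Poly_Mapping.keys (da_op M m as)"
  shows "n \<in> gens M" "path A (rid M m) as (rid M n)"
proof -
  from assms have "da_op M m as \<noteq> 0"
    by auto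
  then obtain t where "path A (rid M m) as t"
    using assms(1,2) unfolding supported_def by blast
  with op_obj[OF assms(2) this assms(3)] show "n \<in> gens M" "path A (rid M m) as (rid M n)"
    by auto
qed

text \<open>
  The relation also holds, for trivial reasons, at inputs starting at the wrong object.  These occur
  in the relation of the dual, which sums over all basis elements of the bimodule.
\<close>

lemma da_rel_off_path:
  assumes "supported A M" "m \<in> gens M" "path A s as t" "s \<noteq> rid M m" "as \<noteq> []"
  shows "da_rel A' A M m as = 0"
proof -
  note zero = da_op_off_path[OF assms(1) _ _ _]
  have "post A' (\<lambda>n. da_op M n (drop k as)) (da_op M m (take k as)) = 0" for k
  proof (cases "take k as = []")
    case True
    then have eq: "take k as = []" "drop k as = as"
      by auto
    have "da_op M n as = 0" if "(c, n) \<in> Poly_Mapping.keys (da_op M m [])" for c n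
      using op_closed[OF assms(1,2) that] assms(3-5) by (intro zero) auto
    then have "post A' (\<lambda>n. da_op M n as) (da_op M m []) = post A' (\<lambda>n. 0) (da_op M m [])"
      by (rule post_cong)
    then show ?thesis
      by (simp add: eq del: take_eq_Nil)
  next
    case False
    then have "da_op M m (take k as) = 0"
      using path_take[OF assms(3), of k] assms(2,4) by (auto intro: zero)
    then show ?thesis by simp
  qed
  moreover have "lin (\<lambda>a. da_op M m (as[j := a])) (dif A (as ! j)) = 0" if "j < length as" for j
  proof -
    have "da_op M m (as[j := a]) = 0" if "a \<in> Poly_Mapping.keys (dif A (as ! j))" for a
      using A.path_update[OF assms(3) \<open>j < length as\<close> that] assms(2,4,5) by (intro zero) auto
    then show ?thesis
      using lin_cong[of "dif A (as ! j)" "\<lambda>a. da_op M m (as[j := a])" "\<lambda>_. 0"] by simp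
  qed
  moreover have "lin (\<lambda>a. da_op M m (take j as @ a # drop (j + 2) as)) (mul A (as ! j)
      (as ! (j + 1))) = 0"
    if "j < length as - 1" for j
  proof -
    have "da_op M m (take j as @ a # drop (j + 2) as) = 0"
      if "a \<in> Poly_Mapping.keys (mul A (as ! j) (as ! (j + 1)))" for a
      using A.path_merge[OF assms(3) \<open>j < length as - 1\<close> that] assms(2,4) by (intro zero) auto
    then show ?thesis
      using lin_cong[of _ "\<lambda>a. da_op M m (take j as @ a # drop (j + 2) as)" "\<lambda>_. 0"] by simp
  qed
  moreover have "da_op M m as = 0"
    using assms by (intro zero)
  ultimately show ?thesis
    by (simp add: da_rel_def)
qed

text \<open>The relation of the left dual is the transpose of the relation of the bimodule.\<close>

lemma ad_rel_left_dual:
  assumes fin: "finite (gens M)" and sup: "supported A M"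
  shows "ad_rel A A' (left_dual M) as m = (\<Sum>m'\<in>gens M. tag m' (comp_at m (da_rel A' A M m' as)))"
proof -
  let ?G = "gens M" and ?N = "left_dual M"
  have closed: "n \<in> ?G" if "m' \<in> ?G" "(c, n) \<in> Poly_Mapping.keys (da_op M m' bs)" for m' bs c n
    using op_closed[OF sup that] by simp
  have comp: "lin (\<lambda>(n, a). lin (\<lambda>(n', a'). lin (\<lambda>p. basis_vec (n', p)) (mul A' a' a)) (ad_op ?N bs
      n)) (ad_op ?N cs m)
     = (\<Sum>m'\<in>?G. tag m' (comp_at m (post A' (\<lambda>n. da_op M n cs) (da_op M m' bs))))" for bs cs
  proof -
    have "tag m' (comp_at m (post A' (\<lambda>n. da_op M n cs) (da_op M m' bs))) =
        (\<Sum>n\<in>?G. lin (\<lambda>a. lin (\<lambda>a'. tag m' (mul A' a' a)) (comp_at n (da_op M m' bs)))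
            (comp_at m (da_op M n cs)))"
      if "m' \<in> ?G" for m'
    proof -
      have 1: "comp_at m (lin (\<lambda>(c', n'). lin (\<lambda>p. basis_vec (p, n')) (mul A' c c')) v)
         = lin (mul A' c) (comp_at m v)" for c v
        unfolding comp_at_def lin_lin
        by (rule lin_cong) (auto simp: lin_lin)
      have "comp_at m (post A' (\<lambda>n. da_op M n cs) (da_op M m' bs)) =
         lin (\<lambda>(c, n). lin (mul A' c) (comp_at m (da_op M n cs))) (da_op M m' bs)"
        unfolding post_def by (subst comp_at_lin) (simp add: case_prod_beta'
            1[unfolded case_prod_beta'])
      also have "\<dots> = (\<Sum>n\<in>?G. lin (\<lambda>c. lin (mul A' c) (comp_at m (da_op M n cs)))
          (comp_at n (da_op M m' bs)))"
        by (rule comp_decompose[OF fin]) (use closed that in blast)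
      also have "\<dots> = (\<Sum>n\<in>?G. lin (\<lambda>a. lin (\<lambda>a'. mul A' a' a) (comp_at n (da_op M m' bs)))
          (comp_at m (da_op M n cs)))"
        by (intro sum.cong refl lin_swap)
      finally show ?thesis
        by (simp add: tag_sum tag_lin)
    qed
    then have "(\<Sum>m'\<in>?G. tag m' (comp_at m (post A' (\<lambda>n. da_op M n cs) (da_op M m' bs)))) =
      (\<Sum>m'\<in>?G. \<Sum>n\<in>?G. lin (\<lambda>a. lin (\<lambda>a'. tag m' (mul A' a' a)) (comp_at n (da_op M m' bs)))
          (comp_at m (da_op M n cs)))"
      by simp
    also have "\<dots> = (\<Sum>n\<in>?G. \<Sum>m'\<in>?G. lin (\<lambda>a. lin (\<lambda>a'. tag m' (mul A' a' a))
        (comp_at n (da_op M m' bs))) (comp_at m (da_op M n cs)))"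
      by (rule sum.swap)
    finally show ?thesis
      by (simp add: ad_op_left_dual lin_sum lin_tag lin_fun_sum flip: tag_def)
  qed
  have split: "(\<Sum>k\<le>length as. lin (\<lambda>(n, a). lin (\<lambda>(n', a'). lin (\<lambda>p. basis_vec (n', p))
      (mul A' a' a))
        (ad_op ?N (take k as) n)) (ad_op ?N (drop k as) m)) =
      (\<Sum>m'\<in>?G. tag m' (comp_at m
        (\<Sum>k\<le>length as. post A' (\<lambda>n. da_op M n (drop k as)) (da_op M m' (take k as)))))"
    unfolding comp comp_at_sum tag_sum by (rule sum.swap)
  have input: "lin (\<lambda>a. ad_op ?N (f a) m) v =
      (\<Sum>m'\<in>?G. tag m' (comp_at m (lin (\<lambda>a. da_op M m' (f a)) v)))" for f v
    by (simp add: ad_op_left_dual lin_fun_sum comp_at_lin tag_lin)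
  have inputs: "(\<Sum>j\<in>J. \<Sum>m'\<in>?G. tag m' (comp_at m (f j m'))) =
      (\<Sum>m'\<in>?G. tag m' (comp_at m (\<Sum>j\<in>J. f j m')))" for f and J :: "nat set"
    unfolding comp_at_sum tag_sum by (rule sum.swap)
  have "lin (\<lambda>(n, a). lin (\<lambda>p. basis_vec (n, p)) (dif A' a)) (ad_op ?N as m) =
      (\<Sum>m'\<in>?G. lin (\<lambda>a. tag m' (dif A' a)) (comp_at m (da_op M m' as)))"
    by (simp add: ad_op_left_dual lin_sum lin_tag flip: tag_def)
  also have "\<dots> = (\<Sum>m'\<in>?G. tag m' (comp_at m
      (lin (\<lambda>(c, n). lin (\<lambda>p. basis_vec (p, n)) (dif A' c)) (da_op M m' as))))"
    by (intro sum.cong refl)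
      (auto simp: comp_at_def lin_lin simp flip: tag_lin intro!: arg_cong[where f = "tag _"]
          lin_cong)
  finally have outputs: "lin (\<lambda>(n, a). lin (\<lambda>p. basis_vec (n, p)) (dif A' a)) (ad_op ?N as m) = \<dots>" .
  show ?thesis
    unfolding ad_rel_def da_rel_def split input inputs outputs
    by (simp add: comp_at_add tag_add sum.distrib)
qed

lemma ad_bimodule_left_dual:
  assumes fin: "finite (gens M)" and sup: "supported A M"
  shows "ad_bimodule A A' (left_dual M)"
proof -
  have keys: "n \<in> gens M \<and> (a, m) \<in> Poly_Mapping.keys (da_op M n cs) \<and>
      path A (rid M n) cs (rid M m) \<and> rid M n = s"
    if "path A s cs (rid M m)" "(n, a) \<in> Poly_Mapping.keys (ad_op (left_dual M) cs m)"
        for s cs m n a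
  proof -
    note n = keys_ad_op_left_dual[OF that(2)]
    note p = op_closed[OF sup n]
    from that(1) p(2) have "rid M n = s"
      by (cases cs) auto
    with n p show ?thesis by simp
  qed
  show ?thesis
  proof (intro ad_bimodule.intro ad_bimodule_axioms.intro A.dg_category_axioms
      A'.dg_category_axioms)
    fix m s cs n a
    assume *: "m \<in> gens (left_dual M)" "path A s cs (lid (left_dual M) m)"
      "(n, a) \<in> Poly_Mapping.keys (ad_op (left_dual M) cs m)"
    then have k: "n \<in> gens M" "(a, m) \<in> Poly_Mapping.keys (da_op M n cs)"
        "path A (rid M n) cs (rid M m)" "rid M n = s"
      using keys[of s cs m n a] by auto
    show "n \<in> gens (left_dual M) \<and> rgt A' a = rid (left_dual M) m \<and> lft A' a = rid (left_dual M) n \<and>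
        lid (left_dual M) n = s"
      using k op_obj[OF k(1,3,2)] by simp
    show "inputs_q A cs + qdeg (left_dual M) m = qdeg (left_dual M) n + cat_q A' a \<and>
       inputs_h A cs + hdeg (left_dual M) m = hdeg (left_dual M) n + (cat_h A' a - 1)"
      using op_deg[OF k(1,3,2)] by simp
  next
    fix m s cs
    assume *: "m \<in> gens (left_dual M)" "path A s cs (lid (left_dual M) m)"
    have "da_rel A' A M m' cs = 0" if "m' \<in> gens M" for m'
    proof (cases "cs = [] \<or> rid M m' = s")
      case True
      with * show ?thesis
        by (auto intro: da_rel_zero[OF that])
    next
      case False
      with * that show ?thesis
        by (auto intro!: da_rel_off_path[OF sup])
    qed
    then have "ad_rel A A' (left_dual M) cs m = 0"
      by (simp add: ad_rel_left_dual[OF fin sup])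
    then show "(\<Sum>k\<le>length cs. lin (\<lambda>(n, a). lin (\<lambda>(n', a'). lin (\<lambda>p. basis_vec (n', p))
        (mul A' a' a))
          (ad_op (left_dual M) (take k cs) n)) (ad_op (left_dual M) (drop k cs) m))
        + (\<Sum>j<length cs. lin (\<lambda>c. ad_op (left_dual M) (cs[j := c]) m) (dif A (cs ! j)))
        + (\<Sum>j<length cs - 1. lin (\<lambda>c. ad_op (left_dual M) (take j cs @ c # drop (j + 2) cs) m)
             (mul A (cs ! j) (cs ! (j + 1))))
        + lin (\<lambda>(n, a). lin (\<lambda>p. basis_vec (n, p)) (dif A' a)) (ad_op (left_dual M) cs m) = 0"
      by (simp only: ad_rel_def)
  next
    fix m assume m: "m \<in> gens (left_dual M)"
    have "tag n (comp_at m (da_op M n [ident A (rid M m)])) =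
        (if n = m then basis_vec (m, ident A' (lid M m)) else 0)" if "n \<in> gens M" for n
    proof (cases "rid M n = rid M m")
      case True
      then show ?thesis
        using unit_2[OF that] by (simp add: comp_at_def tag_def)
    next
      case False
      then have "da_op M n [ident A (rid M m)] = 0"
        using that by (intro da_op_off_path[OF sup, where s = "rid M m"]) (auto simp: A.ident_obj)
      with False show ?thesis by auto
    qed
    then show "ad_op (left_dual M) [ident A (lid (left_dual M) m)] m =
        basis_vec (m, ident A' (rid (left_dual M) m))"
      using fin m by (simp add: ad_op_left_dual)
  next
    fix m s cs r
    assume *: "m \<in> gens (left_dual M)" "path A s cs (lid (left_dual M) m)" "length cs > 1"
        "ident A r \<in> set cs"
    have "da_op M n cs = 0" if "n \<in> gens M" for n
    proof (cases "rid M n = s")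
      case True
      with * that show ?thesis
        by (auto intro: unit_higher)
    next
      case False
      with * that show ?thesis
        by (auto intro!: da_op_off_path[OF sup])
    qed
    then show "ad_op (left_dual M) cs m = 0"
      by (simp add: ad_op_left_dual)
  qed
qed

end

section \<open>Box tensor products\<close>

text \<open>
  DA bimodules whose only operations are the differential \<open>\<delta>\<^sup>1\<^sub>1\<close> and the action \<open>\<delta>\<^sup>1\<^sub>2\<close>.
\<close>

definition no_higher :: "('l, 'r, 'c, 'a, 'b) da \<Rightarrow> bool"
  where "no_higher M \<longleftrightarrow> (\<forall>m\<in>gens M. \<forall>as. length as > 1 \<longrightarrow> da_op M m as = 0)"

text \<open>The map \<open>d \<otimes> m \<mapsto> d \<otimes> (m \<boxtimes> n)\<close>.\<close>

definition pair_right :: "'n \<Rightarrow> (('d \<times> 'm) \<Rightarrow>\<^sub>0 bit) \<Rightarrow> ('d \<times> ('m \<times> 'n)) \<Rightarrow>\<^sub>0 bit"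
  where "pair_right n v = lin (\<lambda>(d, m). basis_vec (d, (m, n))) v"

text \<open>
  The map \<open>c \<otimes> n \<mapsto> (m \<cdot> c) \<boxtimes> n\<close>: the output of an operation of the right factor acts on the left
  factor.
\<close>

definition act_through ::
    "('k, 'l, 'd, 'c, 'm) da \<Rightarrow> 'm \<Rightarrow> (('c \<times> 'n) \<Rightarrow>\<^sub>0 bit) \<Rightarrow> ('d \<times> ('m \<times> 'n)) \<Rightarrow>\<^sub>0 bit"
  where "act_through M m v = lin (\<lambda>(c, n). pair_right n (da_op M m [c])) v"

lemma pair_right_zero [simp]: "pair_right n 0 = 0"
  by (simp add: pair_right_def)

lemma pair_right_add: "pair_right n (v + w) = pair_right n v + pair_right n w"
  by (simp add: pair_right_def)

lemma pair_right_lin: "pair_right n (lin f v) = lin (\<lambda>b. pair_right n (f b)) v"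
  by (simp add: pair_right_def lin_lin)

lemma lin_pair_right: "lin f (pair_right n v) = lin (\<lambda>(d, m). f (d, (m, n))) v"
  by (simp add: pair_right_def lin_lin case_prod_beta')

lemma keys_pair_right:
  "(d, (m, n')) \<in> Poly_Mapping.keys (pair_right n v) \<Longrightarrow> n' = n \<and> (d, m) \<in> Poly_Mapping.keys v"
  unfolding pair_right_def by (auto dest!: keys_lin)

lemma act_through_zero [simp]: "act_through M m 0 = 0"
  by (simp add: act_through_def)

lemma act_through_add: "act_through M m (v + w) = act_through M m v + act_through M m w"
  by (simp add: act_through_def)

lemma act_through_sum: "act_through M m (\<Sum>i\<in>I. f i) = (\<Sum>i\<in>I. act_through M m (f i))"
  by (simp add: act_through_def lin_sum)

lemma act_through_lin: "act_through M m (lin f v) = lin (\<lambda>b. act_through M m (f b)) v"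
  by (simp add: act_through_def lin_lin)

lemma da_iter_length:
  "(cs, n') \<in> Poly_Mapping.keys (da_iter N j n as) \<Longrightarrow> length cs = j"
proof (induction j arbitrary: cs n as n')
  case 0
  then show ?case by (simp split: if_splits)
next
  case (Suc j)
  from Suc.prems obtain k where
    "(cs, n') \<in> Poly_Mapping.keys (lin (\<lambda>(c, n'). lin (\<lambda>(cs, n''). basis_vec (c # cs, n''))
        (da_iter N j n' (drop k as)))
        (da_op N n (take k as)))"
    using keys_sum by fastforce
  then show ?case
    by (auto dest!: keys_lin Suc.IH)
qed

lemma ad_iter_length:
  "(n', as) \<in> Poly_Mapping.keys (ad_iter N j cs n) \<Longrightarrow> length as = j"
proof (induction j arbitrary: cs n as n')
  case 0
  then show ?case by (simp split: if_splits)
next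
  case (Suc j)
  from Suc.prems obtain k where
    "(n', as) \<in> Poly_Mapping.keys (lin (\<lambda>(n', a). lin (\<lambda>(n'', as). basis_vec (n'', as @ [a]))
        (ad_iter N j (take k cs) n'))
            (ad_op N (drop k cs) n))"
    using keys_sum by fastforce
  then show ?case
    by (auto dest!: keys_lin Suc.IH)
qed

lemma da_iter_1: "da_iter N 1 n as = lin (\<lambda>(c, n'). basis_vec ([c], n')) (da_op N n as)"
proof -
  have "lin (\<lambda>(c, n'). lin (\<lambda>(cs, n''). basis_vec (c # cs, n'')) (da_iter N 0 n' (drop k as)))
      (da_op N n (take k as))
      = (if k = length as then lin (\<lambda>(c, n'). basis_vec ([c], n')) (da_op N n as) else 0)"
    if "k \<in> {..length as}" for k
    using that by (cases "k = length as") (auto simp: case_prod_beta')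
  then show ?thesis
    unfolding One_nat_def da_iter.simps(2) by (subst sum.cong[OF refl]) auto
qed

lemma ad_iter_1: "ad_iter N 1 cs n = lin (\<lambda>(n', a). basis_vec (n', [a])) (ad_op N cs n)"
proof -
  have "lin (\<lambda>(n', a). lin (\<lambda>(n'', as). basis_vec (n'', as @ [a])) (ad_iter N 0 (take k cs) n'))
      (ad_op N (drop k cs) n)
      = (if k = 0 then lin (\<lambda>(n', a). basis_vec (n', [a])) (ad_op N cs n) else 0)"
    if "k \<in> {..length cs}" for k
    using that by (cases "k = 0"; cases "cs = []") (auto simp: case_prod_beta')
  then show ?thesis
    unfolding One_nat_def ad_iter.simps(2) by (subst sum.cong[OF refl]) auto
qed

lemma da_box_term_0: "da_box_term M N 0 (m, n) as = (if as = [] then pair_right n (da_op M m [])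
    else 0)"
  by (simp add: da_box_term_def pair_right_def)

lemma da_box_term_1: "da_box_term M N 1 (m, n) as = act_through M m (da_op N n as)"
  unfolding da_box_term_def da_iter_1
  by (simp add: act_through_def lin_lin pair_right_def case_prod_beta')

lemma da_box_term_ge_2:
  assumes "no_higher M" "m \<in> gens M" "j \<ge> 2"
  shows "da_box_term M N j (m, n) as = 0"
proof -
  have "da_op M m cs = 0" if "(cs, n') \<in> Poly_Mapping.keys (da_iter N j n as)" for cs n'
    using da_iter_length[OF that] assms by (simp add: no_higher_def)
  then have "da_box_term M N j (m, n) as = lin (\<lambda>(cs, n'). 0) (da_iter N j n as)"
    unfolding da_box_term_def by (simp, intro lin_cong2) simp
  then show ?thesis
    by (simp add: case_prod_beta')
qed

lemma Sum_any_0_1: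
  fixes f :: "nat \<Rightarrow> 'b \<Rightarrow>\<^sub>0 bit"
  assumes "\<And>j. j \<ge> 2 \<Longrightarrow> f j = 0"
  shows "Sum_any f = f 0 + f 1" "finite {j. f j \<noteq> 0}"
proof -
  have sub: "{j. f j \<noteq> 0} \<subseteq> {0, 1}"
    using assms by (auto simp: not_less_eq_eq numeral_2_eq_2) (metis Suc_leI Suc_lessI neq0_conv)
  then show "finite {j. f j \<noteq> 0}"
    by (rule finite_subset) simp
  show "Sum_any f = f 0 + f 1"
    using Sum_any.expand_superset[OF _ sub] by simp
qed

lemma da_box_sel [simp]:
  "gens (da_box M N) = {(m, n). m \<in> gens M \<and> n \<in> gens N \<and> rid M m = lid N n}"
  "lid (da_box M N) = (\<lambda>(m, n). lid M m)" "rid (da_box M N) = (\<lambda>(m, n). rid N n)"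
  "qdeg (da_box M N) = (\<lambda>(m, n). qdeg M m + qdeg N n)"
  "hdeg (da_box M N) = (\<lambda>(m, n). hdeg M m + hdeg N n)"
  by (simp_all add: da_box_def)

text \<open>
  When the left factor has no higher operations, only the terms with at most one output of the right
  factor survive.
\<close>

lemma da_op_box:
  assumes "no_higher M" "m \<in> gens M"
  shows "da_op (da_box M N) (m, n) as =
     (if as = [] then pair_right n (da_op M m []) else 0) + act_through M m (da_op N n as)"
proof -
  have "da_op (da_box M N) (m, n) as = Sum_any (\<lambda>j. da_box_term M N j (m, n) as)"
    by (simp add: da_box_def)
  also have "\<dots> = da_box_term M N 0 (m, n) as + da_box_term M N 1 (m, n) as"
    by (rule Sum_any_0_1) (rule da_box_term_ge_2[OF assms])
  finally show ?thesis
    by (simp only: da_box_term_0 da_box_term_1)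
qed

lemma da_box_defined_no_higher: "no_higher M \<Longrightarrow> da_box_defined A M N"
  unfolding da_box_defined_def by (auto intro!: Sum_any_0_1(2) da_box_term_ge_2)

text \<open>
  The map \<open>c \<otimes> n \<mapsto> f c \<boxtimes> n\<close>; \<open>act_through M m\<close> is the case \<open>f c = m \<cdot> c\<close>.
\<close>

definition push :: "(('c \<times> 'n) \<Rightarrow>\<^sub>0 bit) \<Rightarrow> ('c \<Rightarrow> ('d \<times> 'm) \<Rightarrow>\<^sub>0 bit) \<Rightarrow> ('d \<times> ('m \<times> 'n)) \<Rightarrow>\<^sub>0 bit"
  where "push v f = lin (\<lambda>(c, n). pair_right n (f c)) v"

text \<open>The differential of the target algebra applied to the output.\<close>

definition dif_out :: "('k, 'd) dgcat \<Rightarrow> (('d \<times> 'm) \<Rightarrow>\<^sub>0 bit) \<Rightarrow> ('d \<times> 'm) \<Rightarrow>\<^sub>0 bit"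
  where "dif_out A v = lin (\<lambda>(d, m'). lin (\<lambda>p. basis_vec (p, m')) (dif A d)) v"

text \<open>
  A composable pair of DA bimodules.  The sums defining the box tensor product are finite because the
  left factor has no higher operations.
\<close>

locale da_box_pair =
  M: da_bimodule A'' A' M + N: da_bimodule A' A N
  for A'' :: "('k::finite, 'd) dgcat" and A' :: "('l::finite, 'c) dgcat"
      and A :: "('r::finite, 'a) dgcat"
    and M :: "('k, 'l, 'd, 'c, 'm) da" and N :: "('l, 'r, 'c, 'a, 'n) da" +
  assumes no_higher: "no_higher M" and supported: "supported A N"
begin

abbreviation "X \<equiv> da_box M N"

lemma op_X: "m \<in> gens M \<Longrightarrow> da_op X (m, n) as =
     (if as = [] then pair_right n (da_op M m []) else 0) + act_through M m (da_op N n as)"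
  by (rule da_op_box[OF no_higher])

lemma N_keys:
  assumes "n \<in> gens N" "(c, n') \<in> Poly_Mapping.keys (da_op N n as)"
  shows "n' \<in> gens N" "path A (rid N n) as (rid N n')" "lft A' c = lid N n" "rgt A' c = lid N n'"
    "qdeg N n + inputs_q A as = cat_q A' c + qdeg N n'"
    "hdeg N n + inputs_h A as = (cat_h A' c - 1) + hdeg N n'"
  using N.op_closed[OF supported assms] N.op_obj[OF assms(1) _ assms(2)] N.op_deg[OF assms(1) _
      assms(2)]
  by blast+

lemma box_keys:
  assumes mn: "m \<in> gens M" "n \<in> gens N" "rid M m = lid N n"
    and k: "(d, (m', n')) \<in> Poly_Mapping.keys (da_op X (m, n) as)"
  obtains (inner) "as = []" "(d, m') \<in> Poly_Mapping.keys (da_op M m [])" "n' = n"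
  | (action) c where "(c, n') \<in> Poly_Mapping.keys (da_op N n as)"
      "(d, m') \<in> Poly_Mapping.keys (da_op M m [c])"
proof -
  from k consider "(d, (m', n')) \<in> Poly_Mapping.keys (if as = [] then pair_right n (da_op M m [])
      else 0)"
    | "(d, (m', n')) \<in> Poly_Mapping.keys (act_through M m (da_op N n as))"
    unfolding op_X[OF mn(1)] keys_add_bit by blast
  then show thesis
  proof cases
    case 1
    then show thesis
      by (auto split: if_splits dest!: keys_pair_right intro: inner)
  next
    case 2
    then show thesis
      unfolding act_through_def by (auto elim!: keys_lin_pair dest!: keys_pair_right intro: action)
  qed
qed

lemma box_keys_obj_deg:
  assumes mn: "m \<in> gens M" "n \<in> gens N" "rid M m = lid N n"
    and k: "(d, (m', n')) \<in> Poly_Mapping.keys (da_op X (m, n) as)"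
  shows "m' \<in> gens M \<and> n' \<in> gens N \<and> rid M m' = lid N n' \<and> lft A'' d = lid M m \<and> rgt A'' d
      = lid M m' \<and>
     path A (rid N n) as (rid N n') \<and>
     qdeg M m + qdeg N n + inputs_q A as = cat_q A'' d + (qdeg M m' + qdeg N n') \<and>
     hdeg M m + hdeg N n + inputs_h A as = (cat_h A'' d - 1) + (hdeg M m' + hdeg N n')"
  using mn k
proof (cases rule: box_keys)
  case inner
  then show ?thesis
    using M.op_obj[OF mn(1) _ inner(2)] M.op_deg[OF mn(1) _ inner(2)] mn
    by (auto simp: inputs_q_def inputs_h_def)
next
  case (action c)
  note Nk = N_keys[OF mn(2) action(1)]
  have p: "path A' (rid M m) [c] (lid N n')"
    using Nk mn(3) by simp
  show ?thesis
    using Nk M.op_obj[OF mn(1) p action(2)] M.op_deg[OF mn(1) p action(2)] mn(3)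
    by (auto simp: inputs_q_def inputs_h_def)
qed

lemma supported_box: "supported A X"
  unfolding supported_def
proof safe
  fix m n as
  assume *: "(m, n) \<in> gens X" "da_op X (m, n) as \<noteq> 0"
  then obtain d m' n' where "(d, (m', n')) \<in> Poly_Mapping.keys (da_op X (m, n) as)"
    by (metis keys_eq_empty all_not_in_conv prod_cases3)
  with box_keys_obj_deg[of m n d m' n' as] *(1) show "\<exists>t. path A (rid X (m, n)) as t"
    by auto
qed

lemma M_long: "m \<in> gens M \<Longrightarrow> da_op M m (a # b # cs) = 0"
  using no_higher by (simp add: no_higher_def)

lemma M_post_long:
  assumes "m \<in> gens M" "path A' (rid M m) cs t"
  shows "post A'' (\<lambda>n. da_op M n (a # b # bs)) (da_op M m cs) = 0"
proof -
  have "post A'' (\<lambda>n. da_op M n (a # b # bs)) (da_op M m cs) = post A'' (\<lambda>n. 0) (da_op M m cs)"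
    by (rule post_cong) (use M.op_obj[OF assms] M_long in blast)
  then show ?thesis by simp
qed

text \<open>
  The relation of the left factor with no, one and two inputs: the differential squares to zero (up
  to the differential of the outputs), it satisfies the Leibniz rule, and the action is associative.
\<close>

lemma M_diff: "m \<in> gens M \<Longrightarrow> post A'' (\<lambda>n. da_op M n []) (da_op M m []) +
    lin (\<lambda>(d, m'). lin (\<lambda>p. basis_vec (p, m')) (dif A'' d)) (da_op M m []) = 0"
  using M.da_rel_zero[of m "[]"] by (simp add: da_rel_def)

lemma M_leibniz: "m \<in> gens M \<Longrightarrow> lft A' c = rid M m \<Longrightarrow>
    post A'' (\<lambda>n. da_op M n [c]) (da_op M m []) + post A'' (\<lambda>n. da_op M n []) (da_op M m [c])
    + lin (\<lambda>a. da_op M m [a]) (dif A' c)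
    + lin (\<lambda>(d, m'). lin (\<lambda>p. basis_vec (p, m')) (dif A'' d)) (da_op M m [c]) = 0"
  using M.da_rel_zero[of m "[c]"] by (simp add: da_rel_def)

lemma M_assoc:
  assumes "m \<in> gens M" "lft A' c = rid M m" "lft A' c' = rgt A' c"
  shows "post A'' (\<lambda>n. da_op M n [c']) (da_op M m [c]) = lin (\<lambda>a. da_op M m [a]) (mul A' c c')"
  using M.da_rel_zero[of m "[c, c']"] assms
  by (simp add: da_rel_def M_long M_post_long[where cs = "[]"] add_eq_zero_bit lessThan_Suc
      atMost_Suc)

lemma post_pair_right: "post B f (pair_right n v) = post B (\<lambda>m. f (m, n)) v"
  by (simp add: post_def lin_pair_right)

lemma pair_right_post: "post B (\<lambda>m. pair_right n (g m)) v = pair_right n (post B g v)"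
  by (simp add: post_def pair_right_lin lin_pair_right case_prod_beta') (simp add: pair_right_def)

lemma post_fun_lin: "post B (\<lambda>m. lin (\<lambda>b. h b m) w) v = lin (\<lambda>b. post B (h b) v) w"
  unfolding post_def by (subst lin_swap) (simp add: lin_lin case_prod_beta')

lemma post_X_pair_right:
  assumes "\<And>d m. (d, m) \<in> Poly_Mapping.keys v \<Longrightarrow> m \<in> gens M"
  shows "post A'' (\<lambda>x. da_op X x bs) (pair_right n v) =
     (if bs = [] then pair_right n (post A'' (\<lambda>m. da_op M m []) v) else 0)
     + lin (\<lambda>(c, n'). pair_right n' (post A'' (\<lambda>m. da_op M m [c]) v)) (da_op N n bs)"
proof -
  have "post A'' (\<lambda>x. da_op X x bs) (pair_right n v) = post A'' (\<lambda>m. da_op X (m, n) bs) v"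
    by (rule post_pair_right)
  also have "\<dots> = post A'' (\<lambda>m. (if bs = [] then pair_right n (da_op M m []) else 0) + act_through M
      m (da_op N n bs)) v"
    by (rule post_cong) (use assms op_X in blast)
  also have "\<dots> = (if bs = [] then pair_right n (post A'' (\<lambda>m. da_op M m []) v) else 0)
     + post A'' (\<lambda>m. act_through M m (da_op N n bs)) v"
    by (simp add: post_fun_add pair_right_post)
  also have "post A'' (\<lambda>m. act_through M m (da_op N n bs)) v =
      lin (\<lambda>(c, n'). pair_right n' (post A'' (\<lambda>m. da_op M m [c]) v)) (da_op N n bs)"
    unfolding act_through_def case_prod_beta' post_fun_lin pair_right_post ..
  finally show ?thesis .
qed

text \<open>
  Letting the product of two outputs of \<open>N\<close> act on \<open>m\<close> is letting the outputs act one after the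
  other.
\<close>

lemma act_through_post:
  assumes mn: "m \<in> gens M" "n \<in> gens N" "rid M m = lid N n" and p: "path A (rid N n) as r"
  shows "act_through M m (post A' (\<lambda>n. da_op N n bs) (da_op N n as)) =
    lin (\<lambda>(c, n'). lin (\<lambda>(c', n''). pair_right n'' (post A'' (\<lambda>m. da_op M m [c']) (da_op M m [c])))
        (da_op N n' bs))
      (da_op N n as)"
proof -
  have "act_through M m (post A' (\<lambda>n. da_op N n bs) (da_op N n as)) =
    lin (\<lambda>(c, n'). lin (\<lambda>(c', n''). pair_right n'' (lin (\<lambda>a. da_op M m [a]) (mul A' c c')))
        (da_op N n' bs))
      (da_op N n as)"
    by (simp add: act_through_def post_def lin_lin case_prod_beta' pair_right_lin)
  also have "\<dots> = lin (\<lambda>(c, n'). lin (\<lambda>(c', n''). pair_right n'' (post A'' (\<lambda>m. da_op M m [c'])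
      (da_op M m [c]))) (da_op N n' bs))
      (da_op N n as)"
  proof (intro lin_cong2)
    fix c n' c' n''
    assume 1: "(c, n') \<in> Poly_Mapping.keys (da_op N n as)"
        and 2: "(c', n'') \<in> Poly_Mapping.keys (da_op N n' bs)"
    note 3 = N_keys[OF mn(2) 1]
    show "pair_right n'' (lin (\<lambda>a. da_op M m [a]) (mul A' c c')) =
       pair_right n'' (post A'' (\<lambda>m. da_op M m [c']) (da_op M m [c]))"
      using M_assoc[of m c c'] mn 3 N_keys[OF 3(1) 2] by simp
  qed
  finally show ?thesis .
qed

lemma da_rel_X:
  assumes mn: "m \<in> gens M" "n \<in> gens N" "rid M m = lid N n" and p: "path A (rid N n) as t"
  shows "da_rel A'' A X (m, n) as = 0"
proof -
  let ?P = "\<lambda>as bs. post A' (\<lambda>n. da_op N n bs) (da_op N n as)"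
  let ?sq = "pair_right n (post A'' (\<lambda>m. da_op M m []) (da_op M m []))"
  let ?dif_act = "push (da_op N n as) (\<lambda>c. post A'' (\<lambda>m. da_op M m [c]) (da_op M m []))"
  let ?act_dif = "push (da_op N n as) (\<lambda>c. post A'' (\<lambda>m. da_op M m []) (da_op M m [c]))"
  let ?act_in = "push (da_op N n as) (\<lambda>c. lin (\<lambda>a. da_op M m [a]) (dif A' c))"
  let ?act_out = "push (da_op N n as) (\<lambda>c. dif_out A'' (da_op M m [c]))"
  let ?N_splits = "act_through M m (\<Sum>k\<le>length as. ?P (take k as) (drop k as))"
  let ?N_difs = "act_through M m (\<Sum>j<length as. lin (\<lambda>a. da_op N n (as[j := a])) (dif A (as ! j)))"
  let ?N_merges = "act_through M m (\<Sum>j<length as - 1. lin (\<lambda>a. da_op N n (take j as @ a # drop (j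
      + 2) as)) (mul A (as ! j) (as ! (j + 1))))"
  have "m' \<in> gens M" if "(d, m') \<in> Poly_Mapping.keys (da_op M m [])" for d m'
    using M.op_obj[OF mn(1) _ that] by simp
  note inner = post_X_pair_right[OF this]
  \<comment> \<open>Only the empty first (second) block of inputs allows the differential of \<open>m\<close> to be taken first (last).\<close>
  have split: "post A'' (\<lambda>x. da_op X x bs) (da_op X (m, n) as') =
     (if as' = [] then (if bs = [] then ?sq else 0) + ?dif_act else 0)
     + ((if bs = [] then ?act_dif else 0)
        + act_through M m (?P as' bs))"
    if as: "as = as' @ bs" for as' bs
  proof -
    obtain r where r: "path A (rid N n) as' r"
      using p unfolding as path_append by blast
    have "m' \<in> gens M" if "(c, n') \<in> Poly_Mapping.keys (da_op N n as')"
        "(d, m') \<in> Poly_Mapping.keys (da_op M m [c])" for c n' d m'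
      using M.op_obj[OF mn(1) _ that(2)] N_keys[OF mn(2) that(1)] mn(3) by simp
    then have "post A'' (\<lambda>x. da_op X x bs) (pair_right n' (da_op M m [c])) =
     (if bs = [] then pair_right n' (post A'' (\<lambda>m. da_op M m []) (da_op M m [c])) else 0)
     + lin (\<lambda>(c', n''). pair_right n'' (post A'' (\<lambda>m. da_op M m [c']) (da_op M m [c]))) (da_op N n'
         bs)"
      if "(c, n') \<in> Poly_Mapping.keys (da_op N n as')" for c n'
      by (intro post_X_pair_right) (use that in blast)
    then have "post A'' (\<lambda>x. da_op X x bs) (act_through M m (da_op N n as')) =
      lin (\<lambda>(c, n'). (if bs = [] then pair_right n' (post A'' (\<lambda>m. da_op M m []) (da_op M m [c]))
          else 0)
     + lin (\<lambda>(c', n''). pair_right n'' (post A'' (\<lambda>m. da_op M m [c']) (da_op M m [c]))) (da_op N n'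
         bs)) (da_op N n as')"
      unfolding act_through_def post_lin by (intro lin_cong) auto
    also have "\<dots> = (if bs = [] then ?act_dif else 0)
        + act_through M m (?P as' bs)"
      unfolding act_through_post[OF mn r]
      by (auto simp add: push_def as case_prod_beta' lin_fun_add)
    finally show ?thesis
      unfolding op_X[OF mn(1)] post_add by (auto simp: inner push_def as)
  qed
  have "(\<Sum>k\<le>length as. post A'' (\<lambda>x. da_op X x (drop k as)) (da_op X (m, n) (take k as))) =
     (\<Sum>k\<le>length as. (if k = 0 then (if as = [] then ?sq else 0) + ?dif_act else 0)
     + ((if k = length as then ?act_dif else 0)
        + act_through M m (?P (take k as) (drop k as))))"
    by (intro sum.cong refl) (subst split; auto)
  also have "\<dots> = (if as = [] then ?sq else 0) + ?dif_act + ?act_dif + ?N_splits"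
    by (simp add: sum.distrib act_through_sum algebra_simps)
  finally have splits: "(\<Sum>k\<le>length as. post A'' (\<lambda>x. da_op X x (drop k as)) (da_op X (m, n)
      (take k as))) = \<dots>" .
  have input: "lin (\<lambda>a. da_op X (m, n) (f a)) v = act_through M m (lin (\<lambda>a. da_op N n (f a)) v)"
    if "\<And>a. f a \<noteq> []" for f v
    using that by (simp add: op_X[OF mn(1)] act_through_lin)
  have difs: "(\<Sum>j<length as. lin (\<lambda>a. da_op X (m, n) (as[j := a])) (dif A (as ! j))) =
      ?N_difs"
    unfolding act_through_sum by (intro sum.cong refl input) auto
  have merges: "(\<Sum>j<length as - 1. lin (\<lambda>a. da_op X (m, n) (take j as @ a # drop (j + 2) as))
      (mul A (as ! j) (as ! (j + 1)))) =
      ?N_merges"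
    unfolding act_through_sum by (intro sum.cong refl input) auto
  have out: "lin (\<lambda>(d, x). lin (\<lambda>p. basis_vec (p, x)) (dif A'' d)) (pair_right n' v)
      = pair_right n' (dif_out A'' v)" for n' v
    unfolding lin_pair_right dif_out_def pair_right_lin
    by (simp add: case_prod_beta' pair_right_lin) (simp add: pair_right_def)
  have outs: "lin (\<lambda>(d, x). lin (\<lambda>p. basis_vec (p, x)) (dif A'' d)) (da_op X (m, n) as) =
      (if as = [] then pair_right n (dif_out A'' (da_op M m [])) else 0) + ?act_out"
    by (simp add: op_X[OF mn(1)] act_through_def lin_lin case_prod_beta' push_def out[unfolded
        case_prod_beta'])
  \<comment> \<open>The relation of \<open>N\<close> leaves the action of the differentials of its outputs on \<open>m\<close>; these are absorbed
      by the Leibniz rule of \<open>M\<close>.\<close>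
  have "?N_splits + ?N_difs + ?N_merges
      = act_through M m (lin (\<lambda>(c, n). lin (\<lambda>p. basis_vec (p, n)) (dif A' c)) (da_op N n as))"
    using N.da_rel_zero[OF mn(2) p] unfolding da_rel_def add_eq_zero_bit
    by (simp flip: act_through_add)
  also have "\<dots> = ?act_in"
    by (simp add: act_through_def push_def lin_lin case_prod_beta' pair_right_lin)
  finally have N_part: "?N_splits + ?N_difs + ?N_merges
      = \<dots>" .
  have "?dif_act + ?act_dif + ?act_in + ?act_out =
      lin (\<lambda>(c, n'). pair_right n' (post A'' (\<lambda>m. da_op M m [c]) (da_op M m [])
        + post A'' (\<lambda>m. da_op M m []) (da_op M m [c]) + lin (\<lambda>a. da_op M m [a]) (dif A' c)
            + dif_out A'' (da_op M m [c])))
      (da_op N n as)"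
    by (simp add: push_def case_prod_beta' lin_fun_add pair_right_add)
  also have "\<dots> = lin (\<lambda>(c, n'). 0) (da_op N n as)"
    by (intro lin_cong2) (use M_leibniz[OF mn(1)] N_keys[OF mn(2)] mn(3) in \<open>simp add: dif_out_def\<close>)
  finally have M_part: "?dif_act + ?act_dif + ?act_in + ?act_out = 0"
    by (simp add: case_prod_beta')
  have empty: "?sq + pair_right n (dif_out A'' (da_op M m [])) = 0"
    using M_diff[OF mn(1)] by (simp add: dif_out_def flip: pair_right_add)
  have regroup: "P + L1 + L2 + S + D + E + (R + L3) = (P + R) + (L1 + L2 + (S + D + E) + L3)"
    for P R L1 L2 L3 S D E :: "'z :: ab_group_add"
    by (simp only: ac_simps)
  show ?thesis
    unfolding da_rel_def splits difs merges outs regroup N_part M_part using empty by simp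
qed

lemma da_bimodule_box: "da_bimodule A'' A X"
proof (rule da_bimoduleI)
  show "dg_category A''" "dg_category A" ..
next
  fix x as t d y
  assume "x \<in> gens X" "path A (rid X x) as t" "(d, y) \<in> Poly_Mapping.keys (da_op X x as)"
  then show "y \<in> gens X \<and> lft A'' d = lid X x \<and> rgt A'' d = lid X y \<and> rid X y = t"
    using box_keys_obj_deg[of "fst x" "snd x" d "fst y" "snd y" as]
    by (auto simp: case_prod_beta' intro: path_unique)
next
  fix x as t d y
  assume "x \<in> gens X" "path A (rid X x) as t" "(d, y) \<in> Poly_Mapping.keys (da_op X x as)"
  then show "qdeg X x + inputs_q A as = cat_q A'' d + qdeg X y \<and>
        hdeg X x + inputs_h A as = (cat_h A'' d - 1) + hdeg X y"
    using box_keys_obj_deg[of "fst x" "snd x" d "fst y" "snd y" as]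
    by (auto simp: case_prod_beta')
next
  fix x as t
  assume "x \<in> gens X" "path A (rid X x) as t"
  then show "da_rel A'' A X x as = 0"
    by (auto intro: da_rel_X)
next
  fix x assume "x \<in> gens X"
  then obtain m n where x: "x = (m, n)" "m \<in> gens M" "n \<in> gens N" "rid M m = lid N n"
    by auto
  then have "da_op M m [ident A' (lid N n)] = basis_vec (ident A'' (lid M m), m)"
    using M.unit_2[of m] by simp
  with x show "da_op X x [ident A (rid X x)] = basis_vec (ident A'' (lid X x), x)"
    by (simp add: op_X N.unit_2 act_through_def pair_right_def)
next
  fix x as t s
  assume "x \<in> gens X" "path A (rid X x) as t" "length as > 1" "ident A s \<in> set as"
  then show "da_op X x as = 0"
    by (auto simp: op_X N.unit_higher)
qed

end

section \<open>Duals of box tensor products\<close>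

lemma ad_box_sel [simp]:
  "gens (ad_box M N) = {(m, n). m \<in> gens M \<and> n \<in> gens N \<and> rid M m = lid N n}"
  "lid (ad_box M N) = (\<lambda>(m, n). lid M m)" "rid (ad_box M N) = (\<lambda>(m, n). rid N n)"
  "qdeg (ad_box M N) = (\<lambda>(m, n). qdeg M m + qdeg N n)"
  "hdeg (ad_box M N) = (\<lambda>(m, n). hdeg M m + hdeg N n)"
  by (simp_all add: ad_box_def)

lemma ad_op_left_dual_long: "no_higher M \<Longrightarrow> length cs > 1 \<Longrightarrow> ad_op (left_dual M) cs m = 0"
  by (simp add: ad_op_left_dual no_higher_def)

lemma ad_box_term_0:
  "ad_box_term N' M' 0 ds (n, m) =
     (if ds = [] then lin (\<lambda>(m', a). basis_vec ((n, m'), a)) (ad_op M' [] m) else 0)"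
  by (simp add: ad_box_term_def)

lemma ad_box_term_1:
  "ad_box_term N' M' 1 ds (n, m) =
     lin (\<lambda>(n', c). lin (\<lambda>(m', a). basis_vec ((n', m'), a)) (ad_op M' [c] m)) (ad_op N' ds n)"
  unfolding ad_box_term_def ad_iter_1 by (simp add: lin_lin case_prod_beta')

lemma ad_box_term_left_dual_ge_2:
  assumes "no_higher M" "j \<ge> 2"
  shows "ad_box_term N' (left_dual M) j ds (n, m) = 0"
proof -
  have "ad_op (left_dual M) cs m = 0" if "(n', cs) \<in> Poly_Mapping.keys (ad_iter N' j ds n)"
      for cs n'
    using ad_iter_length[OF that] assms by (simp add: ad_op_left_dual_long)
  then have "ad_box_term N' (left_dual M) j ds (n, m) = lin (\<lambda>(n', cs). 0) (ad_iter N' j ds n)"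
    unfolding ad_box_term_def by (simp, intro lin_cong2) simp
  then show ?thesis
    by (simp add: case_prod_beta')
qed

lemma ad_op_box_left_dual:
  assumes "no_higher M"
  shows "ad_op (ad_box N' (left_dual M)) ds (n, m) =
     (if ds = [] then lin (\<lambda>(m', a). basis_vec ((n, m'), a)) (ad_op (left_dual M) [] m) else 0) +
     lin (\<lambda>(n', c). lin (\<lambda>(m', a). basis_vec ((n', m'), a)) (ad_op (left_dual M) [c] m))
         (ad_op N' ds n)"
proof -
  have "ad_op (ad_box N' (left_dual M)) ds (n, m) = Sum_any (\<lambda>j. ad_box_term N' (left_dual M) j ds
      (n, m))"
    by (simp add: ad_box_def)
  also have "\<dots> = ad_box_term N' (left_dual M) 0 ds (n, m) + ad_box_term N' (left_dual M) 1 ds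
      (n, m)"
    by (rule Sum_any_0_1) (rule ad_box_term_left_dual_ge_2[OF assms])
  finally show ?thesis
    by (simp only: ad_box_term_0 ad_box_term_1)
qed

lemma ad_box_defined_left_dual: "no_higher M \<Longrightarrow> ad_box_defined A N' (left_dual M)"
  unfolding ad_box_defined_def by (auto intro!: Sum_any_0_1(2) ad_box_term_left_dual_ge_2)

context da_box_pair
begin

text \<open>The dual of a box tensor product is the box tensor product of the duals in the opposite order.\<close>

lemma ad_op_left_dual_box:
  assumes fin: "finite (gens M)" "finite (gens N)" and sup_M: "supported A' M"
    and mn: "m \<in> gens M" "n \<in> gens N" "rid M m = lid N n"
  shows "ad_op (ad_box (left_dual N) (left_dual M)) ds (n, m) =
     lin (\<lambda>(x, a). basis_vec (prod.swap x, a)) (ad_op (left_dual X) ds (m, n))"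
proof -
  let ?G = "gens X"
  have pr: "comp_at (m, n) (pair_right n' v) = (if n' = n then comp_at m v else 0)" for n' v
    unfolding comp_at_def lin_pair_right
    by (auto simp: case_prod_beta' intro: lin_cong)
  have act: "comp_at (m, n) (act_through M m' v) = lin (\<lambda>c. comp_at m (da_op M m' [c]))
      (comp_at n v)" for m' v
    unfolding act_through_def comp_at_lin case_prod_beta' pr
    by (simp add: comp_at_def[of n] lin_lin case_prod_beta' if_distrib[of "lin _"] cong: if_cong)
  have "lin (\<lambda>(x, a). basis_vec (prod.swap x, a)) (ad_op (left_dual X) ds (m, n)) =
     (\<Sum>(m', n')\<in>?G. tag (n', m') (comp_at (m, n) (da_op X (m', n') ds)))"
    unfolding ad_op_left_dual lin_sum by (intro sum.cong refl) (auto simp: tag_def lin_lin)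
  also have "\<dots> = (\<Sum>(m', n')\<in>?G.
       (if ds = [] \<and> n' = n then tag (n', m') (comp_at m (da_op M m' [])) else 0)
      + tag (n', m') (lin (\<lambda>c. comp_at m (da_op M m' [c])) (comp_at n (da_op N n' ds))))"
    by (intro sum.cong refl) (auto simp: op_X comp_at_add tag_add pr act)
  also have "\<dots> = (\<Sum>(m', n')\<in>gens M \<times> gens N.
       (if ds = [] \<and> n' = n then tag (n', m') (comp_at m (da_op M m' [])) else 0)
      + tag (n', m') (lin (\<lambda>c. comp_at m (da_op M m' [c])) (comp_at n (da_op N n' ds))))"
  \<comment> \<open>Pairs whose objects do not match contribute nothing, so the sum may range over the full product.\<close>
  proof (intro sum.mono_neutral_left)
    show "\<forall>x\<in>gens M \<times> gens N - ?G. (case x of (m', n') \<Rightarrow>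
       (if ds = [] \<and> n' = n then tag (n', m') (comp_at m (da_op M m' [])) else 0)
      + tag (n', m') (lin (\<lambda>c. comp_at m (da_op M m' [c])) (comp_at n (da_op N n' ds)))) = 0"
    proof safe
      fix m' n' assume *: "m' \<in> gens M" "n' \<in> gens N" "(m', n') \<notin> gens X"
      then have ne: "rid M m' \<noteq> lid N n'"
        by auto
      have "comp_at m (da_op M m' []) = 0" if "n' = n"
      proof (rule ccontr)
        assume "comp_at m (da_op M m' []) \<noteq> 0"
        then obtain c where "c \<in> Poly_Mapping.keys (comp_at m (da_op M m' []))"
          by (metis keys_eq_empty all_not_in_conv)
        then have "(c, m) \<in> Poly_Mapping.keys (da_op M m' [])"
          by (rule keys_comp_at)
        with M.op_obj[OF *(1) _ this] ne mn that show False
          by simp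
      qed
      moreover have "lin (\<lambda>c. comp_at m (da_op M m' [c])) (comp_at n (da_op N n' ds)) =
          lin (\<lambda>c. 0) (comp_at n (da_op N n' ds))"
      proof (rule lin_cong)
        fix c assume "c \<in> Poly_Mapping.keys (comp_at n (da_op N n' ds))"
        then have "lft A' c = lid N n'" "rgt A' c = lid N n"
          using N_keys[OF *(2)] keys_comp_at by metis+
        then have "da_op M m' [c] = 0"
          using M.da_op_off_path[OF sup_M *(1), of "lid N n'" "[c]"] ne by auto
        then show "comp_at m (da_op M m' [c]) = 0"
          by simp
      qed
      ultimately show "(if ds = [] \<and> n' = n then tag (n', m') (comp_at m (da_op M m' [])) else 0)
          + tag (n', m') (lin (\<lambda>c. comp_at m (da_op M m' [c])) (comp_at n (da_op N n' ds))) = 0"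
        by simp
    qed
  qed (use fin in auto)
  also have "\<dots> = (\<Sum>m'\<in>gens M. if ds = [] then tag (n, m') (comp_at m (da_op M m' [])) else 0)
     + (\<Sum>n'\<in>gens N. \<Sum>m'\<in>gens M. tag (n', m') (lin (\<lambda>c. comp_at m (da_op M m' [c]))
         (comp_at n (da_op N n' ds))))"
  proof -
    have *: "(\<Sum>(m', n')\<in>gens M \<times> gens N. p m' n' + q m' n') =
        (\<Sum>m'\<in>gens M. \<Sum>n'\<in>gens N. p m' n') + (\<Sum>n'\<in>gens N. \<Sum>m'\<in>gens M. q m' n')"
      for p q :: "_ \<Rightarrow> _ \<Rightarrow> _ \<Rightarrow>\<^sub>0 bit"
      unfolding sum.swap[of "\<lambda>n' m'. q m' n'"] sum.cartesian_product[symmetric]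
      by (simp add: sum.distrib)
    show ?thesis
      unfolding * using mn(2) fin by (cases "ds = []") simp_all
  qed
  also have "\<dots> = ad_op (ad_box (left_dual N) (left_dual M)) ds (n, m)"
    unfolding ad_op_box_left_dual[OF no_higher] ad_op_left_dual
    by (simp add: lin_sum lin_tag lin_fun_sum tag_lin flip: tag_def)
  finally show ?thesis ..
qed

end

text \<open>The map \<open>n \<otimes> a \<mapsto> f n \<otimes> a\<close>.\<close>

definition relabel :: "('b \<Rightarrow> 'd) \<Rightarrow> (('b \<times> 'a) \<Rightarrow>\<^sub>0 bit) \<Rightarrow> ('d \<times> 'a) \<Rightarrow>\<^sub>0 bit"
  where "relabel f v = lin (\<lambda>(m, a). basis_vec (f m, a)) v"

lemma relabel_lin: "relabel f (lin g v) = lin (\<lambda>b. relabel f (g b)) v"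
  by (simp add: relabel_def lin_lin)

lemma relabel_add: "relabel f (v + w) = relabel f v + relabel f w"
  by (simp add: relabel_def)

lemma relabel_sum: "relabel f (\<Sum>i\<in>I. g i) = (\<Sum>i\<in>I. relabel f (g i))"
  by (simp add: relabel_def lin_sum)

lemma relabel_basis: "relabel f (basis_vec (n, a)) = basis_vec (f n, a)"
  by (simp add: relabel_def)

lemma lin_relabel: "lin (\<lambda>(n, a). g n a) (relabel f v) = lin (\<lambda>(n, a). g (f n) a) v"
  by (simp add: relabel_def lin_lin case_prod_beta')

lemma keys_relabel:
  "(n', a) \<in> Poly_Mapping.keys (relabel f v) \<Longrightarrow> \<exists>n. n' = f n \<and> (n, a) \<in> Poly_Mapping.keys v"
  unfolding relabel_def by (auto dest!: keys_lin)

lemma ad_bimodule_transfer: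
  assumes N: "ad_bimodule A' A N" and iso: "ad_iso_by A' f N N'"
  shows "ad_bimodule A' A N'"
proof -
  interpret ad_bimodule A' A N by (fact N)
  have gens': "gens N' = f ` gens N"
    using iso by (simp add: ad_iso_by_def bij_betw_def)
  have op: "ad_op N' cs (f n) = relabel f (ad_op N cs n)" if "n \<in> gens N" "path A' s cs (lid N n)"
      for s cs n
    using iso that unfolding ad_iso_by_def relabel_def by blast
  have sel: "lid N' (f n) = lid N n" "rid N' (f n) = rid N n" "qdeg N' (f n) = qdeg N n"
      "hdeg N' (f n) = hdeg N n"
    if "n \<in> gens N" for n
    using iso that unfolding ad_iso_by_def by blast+
  have rel: "ad_rel A' A N' cs (f m) = relabel f (ad_rel A' A N cs m)"
    if m: "m \<in> gens N" and p: "path A' s cs (lid N m)" for s cs m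
  proof -
    have "lin (\<lambda>(n, a). lin (\<lambda>(n', a'). lin (\<lambda>p. basis_vec (n', p)) (mul A a' a))
        (ad_op N' (take k cs) n)) (ad_op N' (drop k cs) (f m))
        = relabel f (lin (\<lambda>(n, a). lin (\<lambda>(n', a'). lin (\<lambda>p. basis_vec (n', p)) (mul A a' a))
            (ad_op N (take k cs) n)) (ad_op N (drop k cs) m))" for k
    proof -
      obtain r where r: "path A' s (take k cs) r" "path A' r (drop k cs) (lid N m)"
        using path_take[OF p] by blast
      have "lin (\<lambda>(n', a'). lin (\<lambda>p. basis_vec (n', p)) (mul A a' a)) (ad_op N' (take k cs) (f n)) =
         relabel f (lin (\<lambda>(n', a'). lin (\<lambda>p. basis_vec (n', p)) (mul A a' a)) (ad_op N (take k cs)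
             n))"
        if "(n, a) \<in> Poly_Mapping.keys (ad_op N (drop k cs) m)" for n a
      proof -
        have n: "n \<in> gens N" "lid N n = r"
          using op_obj[OF m r(2) that] by auto
        show ?thesis
          using op[OF n(1), unfolded n(2), OF r(1)]
          by (simp add: relabel_def lin_lin case_prod_beta')
      qed
      then show ?thesis
        unfolding op[OF m r(2)] lin_relabel relabel_lin by (intro lin_cong) (auto simp: relabel_lin)
    qed
    moreover have "lin (\<lambda>c. ad_op N' (cs[j := c]) (f m)) (dif A' (cs ! j))
        = relabel f (lin (\<lambda>c. ad_op N (cs[j := c]) m) (dif A' (cs ! j)))"
      if "j < length cs" for j
      unfolding relabel_lin using A'.path_update[OF p that] by (intro lin_cong op[OF m]) blast
    moreover have "lin (\<lambda>c. ad_op N' (take j cs @ c # drop (j + 2) cs) (f m)) (mul A' (cs ! j)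
        (cs ! (j + 1)))
       = relabel f (lin (\<lambda>c. ad_op N (take j cs @ c # drop (j + 2) cs) m) (mul A' (cs ! j)
           (cs ! (j + 1))))"
      if "j < length cs - 1" for j
      unfolding relabel_lin using A'.path_merge[OF p that] by (intro lin_cong op[OF m]) blast
    moreover have "lin (\<lambda>(n, a). lin (\<lambda>p. basis_vec (n, p)) (dif A a)) (ad_op N' cs (f m)) =
       relabel f (lin (\<lambda>(n, a). lin (\<lambda>p. basis_vec (n, p)) (dif A a)) (ad_op N cs m))"
      unfolding op[OF m p] lin_relabel by (simp add: relabel_lin case_prod_beta' relabel_basis)
    ultimately show ?thesis
      unfolding ad_rel_def relabel_add relabel_sum by simp
  qed
  show ?thesis
  proof (intro ad_bimodule.intro ad_bimodule_axioms.intro A.dg_category_axioms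
      A'.dg_category_axioms)
    fix m' s cs n' a
    assume *: "m' \<in> gens N'" "path A' s cs (lid N' m')"
        "(n', a) \<in> Poly_Mapping.keys (ad_op N' cs m')"
    then obtain m where m: "m \<in> gens N" "m' = f m" "path A' s cs (lid N m)"
      unfolding gens' by (auto simp: sel)
    then obtain n where n: "n' = f n" "(n, a) \<in> Poly_Mapping.keys (ad_op N cs m)"
      using * op keys_relabel by metis
    note 1 = op_obj[OF m(1,3) n(2)] op_deg[OF m(1,3) n(2)]
    show "n' \<in> gens N' \<and> rgt A a = rid N' m' \<and> lft A a = rid N' n' \<and> lid N' n' = s"
      using 1 m n by (auto simp: gens' sel)
    show "inputs_q A' cs + qdeg N' m' = qdeg N' n' + cat_q A a \<and>
        inputs_h A' cs + hdeg N' m' = hdeg N' n' + (cat_h A a - 1)"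
      using 1 m n by (auto simp: sel)
  next
    fix m' s cs
    assume *: "m' \<in> gens N'" "path A' s cs (lid N' m')"
    then obtain m where m: "m \<in> gens N" "m' = f m" "path A' s cs (lid N m)"
      unfolding gens' by (auto simp: sel)
    have "ad_rel A' A N cs m = 0"
      using relation[OF m(1,3)] by (simp only: ad_rel_def)
    then have "ad_rel A' A N' cs m' = 0"
      using rel[OF m(1,3)] m(2) by (simp add: relabel_def)
    then show "(\<Sum>k\<le>length cs. lin (\<lambda>(n, a). lin (\<lambda>(n', a'). lin (\<lambda>p. basis_vec (n', p))
        (mul A a' a))
          (ad_op N' (take k cs) n)) (ad_op N' (drop k cs) m'))
        + (\<Sum>j<length cs. lin (\<lambda>c. ad_op N' (cs[j := c]) m') (dif A' (cs ! j)))
        + (\<Sum>j<length cs - 1. lin (\<lambda>c. ad_op N' (take j cs @ c # drop (j + 2) cs) m')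
             (mul A' (cs ! j) (cs ! (j + 1))))
        + lin (\<lambda>(n, a). lin (\<lambda>p. basis_vec (n, p)) (dif A a)) (ad_op N' cs m') = 0"
      by (simp only: ad_rel_def)
  next
    fix m' assume "m' \<in> gens N'"
    then obtain m where m: "m \<in> gens N" "m' = f m"
      unfolding gens' by auto
    then have "ad_op N' [ident A' (lid N m)] (f m) = relabel f (ad_op N [ident A' (lid N m)] m)"
      by (intro op[where s = "lid N m"]) (auto simp: A'.ident_obj)
    with m show "ad_op N' [ident A' (lid N' m')] m' = basis_vec (m', ident A (rid N' m'))"
      by (simp add: sel unit_2 relabel_basis)
  next
    fix m' s cs r
    assume *: "m' \<in> gens N'" "path A' s cs (lid N' m')" "length cs > 1" "ident A' r \<in> set cs"
    then obtain m where m: "m \<in> gens N" "m' = f m" "path A' s cs (lid N m)"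
      unfolding gens' by (auto simp: sel)
    with * show "ad_op N' cs m' = 0"
      by (simp add: op[OF m(1,3)] unit_higher[OF m(1,3)] relabel_def)
  qed
qed

section \<open>The algebras\<close>

lemma lft_A2 [simp]: "lft A2 = obj_mon2" and rgt_A2 [simp]: "rgt A2 = obj_mon2"
  and cat_q_A2 [simp]: "cat_q A2 a = - h_mon2 a" and cat_h_A2 [simp]: "cat_h A2 = h_mon2"
  and ident_A2 [simp]: "ident A2 Obj_u = Mon_u 0" "ident A2 Obj_o = Mon_o 0 0"
  and mul_A2 [simp]: "mul A2 = mul_mon2" and dif_A2 [simp]: "dif A2 = (\<lambda>_. 0)"
  by (simp_all add: A2_def)

lemma lft_A11 [simp]: "lft A11 = lft_mon11" and rgt_A11 [simp]: "rgt A11 = rgt_mon11"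
  and cat_q_A11 [simp]: "cat_q A11 = q_mon11" and cat_h_A11 [simp]: "cat_h A11 = h_mon11"
  and ident_A11 [simp]: "ident A11 Obj_uu = M_uu" "ident A11 Obj_ou = M_ou 0"
    "ident A11 Obj_uo = M_uo 0" "ident A11 Obj_oo = M_oo 0 0"
  and mul_A11 [simp]: "mul A11 = mul_mon11" and dif_A11 [simp]: "dif A11 = (\<lambda>_. 0)"
  by (simp_all add: A11_def)

lemma dg_category_A2: "dg_category A2"
proof
  fix a :: mon2 and s
  show "lft A2 (ident A2 s) = s" "rgt A2 (ident A2 s) = s"
    by (cases s; simp)+
  show "mul A2 (ident A2 (lft A2 a)) a = basis_vec a" "mul A2 a (ident A2 (rgt A2 a)) = basis_vec a"
    by (cases a; simp)+
  fix b c :: mon2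
  show "mul A2 a b = 0" if "rgt A2 a \<noteq> lft A2 b"
    using that by (cases a; cases b) auto
  show "lft A2 c = lft A2 a \<and> rgt A2 c = rgt A2 b"
    "cat_q A2 c = cat_q A2 a + cat_q A2 b \<and> cat_h A2 c = cat_h A2 a + cat_h A2 b"
    if "c \<in> Poly_Mapping.keys (mul A2 a b)"
    using that by (cases a; cases b; simp)+
  show "lin (\<lambda>d. mul A2 d c) (mul A2 a b) = lin (mul A2 a) (mul A2 b c)"
    by (cases a; cases b; cases c) (simp_all add: add.assoc)
qed simp_all

lemma dg_category_A11: "dg_category A11"
proof
  fix a :: mon11 and s
  show "lft A11 (ident A11 s) = s" "rgt A11 (ident A11 s) = s"
    by (cases s; simp)+
  show "mul A11 (ident A11 (lft A11 a)) a = basis_vec a"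
      "mul A11 a (ident A11 (rgt A11 a)) = basis_vec a"
    by (cases a; simp)+
  fix b c :: mon11
  show "mul A11 a b = 0" if "rgt A11 a \<noteq> lft A11 b"
    using that by (cases a; cases b) auto
  show "lft A11 c = lft A11 a \<and> rgt A11 c = rgt A11 b"
    "cat_q A11 c = cat_q A11 a + cat_q A11 b \<and> cat_h A11 c = cat_h A11 a + cat_h A11 b"
    if "c \<in> Poly_Mapping.keys (mul A11 a b)"
    using that by (cases a; cases b; simp split: if_splits)+
  show "lin (\<lambda>d. mul A11 d c) (mul A11 a b) = lin (mul A11 a) (mul A11 b c)"
    by (cases a; cases b; cases c) (simp_all add: add.assoc)
qed simp_all

interpretation A2: dg_category A2 by (rule dg_category_A2)
interpretation A11: dg_category A11 by (rule dg_category_A11)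

lemma deg_ident_A2: "cat_q A2 (ident A2 s) = 0 \<and> cat_h A2 (ident A2 s) = 0"
  by (cases s) simp_all

lemma deg_ident_A11: "cat_q A11 (ident A11 s) = 0 \<and> cat_h A11 (ident A11 s) = 0"
  by (cases s) simp_all

section \<open>The bimodule \<open>\<Lambda>\<close>\<close>

lemma Lambda_sel [simp]: "gens Lambda_bim = UNIV" "lid Lambda_bim = lid_L" "rid Lambda_bim = rid_L"
  "qdeg Lambda_bim Gen_x = -1" "qdeg Lambda_bim Gen_y = 0" "qdeg Lambda_bim Gen_z = 0"
  "hdeg Lambda_bim Gen_x = 1" "hdeg Lambda_bim Gen_y = 0" "hdeg Lambda_bim Gen_z = 0"
  "da_op Lambda_bim = op_L"
  by (simp_all add: Lambda_bim_def)

text \<open>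
  The homological degrees of \<open>e\<^sub>1\<close> and \<open>e\<^sub>2\<close>; their quantum degrees are the negatives.
\<close>

fun h_gen2 :: "gen2 \<Rightarrow> int"
  where "h_gen2 Gen_e1 = 2" | "h_gen2 Gen_e2 = 4"

lemma step_L_keys:
  "(c, n) \<in> Poly_Mapping.keys (step_L m g) \<Longrightarrow>
      lft A11 c = lid_L m \<and> rgt A11 c = lid_L n \<and> rid_L n = rid_L m \<and>
      qdeg Lambda_bim m + - h_gen2 g = cat_q A11 c + qdeg Lambda_bim n \<and>
      hdeg Lambda_bim m + h_gen2 g = cat_h A11 c + hdeg Lambda_bim n"
  by (cases m; cases g) (auto simp: keys_add_bit)

lemma word_L_keys:
  assumes "(c, n) \<in> Poly_Mapping.keys (word_act A11 lid_L step_L m gs)"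
  shows "lft A11 c = lid_L m \<and> rgt A11 c = lid_L n \<and> rid_L n = rid_L m \<and>
      qdeg Lambda_bim m + (\<Sum>g\<leftarrow>gs. - h_gen2 g) = cat_q A11 c + qdeg Lambda_bim n \<and>
      hdeg Lambda_bim m + (\<Sum>g\<leftarrow>gs. h_gen2 g) = cat_h A11 c + hdeg Lambda_bim n"
  by (rule A11.keys_word_act[OF step_L_keys deg_ident_A11 assms])

lemma step_L_commute:
  "post A11 (\<lambda>n. step_L n h) (step_L m g) = post A11 (\<lambda>n. step_L n g) (step_L m h)"
  by (cases m; cases g; cases h) (simp_all add: post_basis_vec post_add)

lemma h_word_mon2: "sum_list (map h_gen2 (word_mon2 a)) = h_mon2 a"
  by (cases a) (simp_all add: sum_list_replicate)

lemma q_word_mon2: "(\<Sum>g\<leftarrow>word_mon2 a. - h_gen2 g) = - h_mon2 a"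
  by (cases a) (simp_all add: sum_list_replicate)

lemma op_L_keys:
  assumes "path A2 (rid_L m) as t" "(c, n) \<in> Poly_Mapping.keys (op_L m as)"
  shows "lft A11 c = lid_L m \<and> rgt A11 c = lid_L n \<and> rid_L n = t \<and>
    qdeg Lambda_bim m + inputs_q A2 as = cat_q A11 c + qdeg Lambda_bim n \<and>
    hdeg Lambda_bim m + inputs_h A2 as = (cat_h A11 c - 1) + hdeg Lambda_bim n"
  using assms
proof (cases "(m, as)" rule: op_L.cases)
  case (2 m' a)
  with assms have "(c, n) \<in> Poly_Mapping.keys (word_act A11 lid_L step_L m (word_mon2 a))"
    by simp
  from word_L_keys[OF this] 2 assms show ?thesis
    by (auto simp: inputs_q_def inputs_h_def h_word_mon2 q_word_mon2)
qed (auto simp: inputs_q_def inputs_h_def split: if_splits)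

text \<open>The right action on \<open>\<Lambda>\<close> is associative.\<close>

lemma op_L_mul:
  assumes "obj_mon2 a = rid_L m" "obj_mon2 b = rid_L m"
  shows "post A11 (\<lambda>n. op_L n [b]) (op_L m [a]) = lin (\<lambda>c. op_L m [c]) (mul A2 a b)"
proof -
  have "post A11 (\<lambda>n. op_L n [b]) (op_L m [a]) =
      post A11 (\<lambda>n. word_act A11 lid_L step_L n (word_mon2 b)) (word_act A11 lid_L step_L m
          (word_mon2 a))"
    using assms word_L_keys[of _ _ m "word_mon2 a"] by (auto intro!: post_cong)
  also have "\<dots> = lin (\<lambda>c. op_L m [c]) (mul A2 a b)"
  proof -
    have nf: "post A11 (\<lambda>n. word_act A11 lid_L step_L n (replicate i' Gen_e1 @ replicate j' Gen_e2))
        (word_act A11 lid_L step_L m (replicate i Gen_e1 @ replicate j Gen_e2)) =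
      word_act A11 lid_L step_L m (replicate (i + i') Gen_e1 @ replicate (j + j')
          Gen_e2)" for i j i' j'
      by (rule A11.word_act_normal_form) (simp_all add: step_L_keys step_L_commute del: lft_A11
          rgt_A11)
    show ?thesis
    proof (cases a; cases b)
      fix i i' assume "a = Mon_u i" "b = Mon_u i'"
      then show ?thesis
        using assms nf[of i' 0 i 0] by auto
    next
      fix i j i' j' assume "a = Mon_o i j" "b = Mon_o i' j'"
      then show ?thesis
        using assms nf[of i' j' i j] by auto
    qed (use assms in auto)
  qed
  finally show ?thesis .
qed

lemma word_L_xy: "word_act A11 lid_L step_L Gen_x (replicate i Gen_e1) = basis_vec (M_ou i, Gen_x)"
  "word_act A11 lid_L step_L Gen_y (replicate i Gen_e1) = basis_vec (M_uo i, Gen_y)"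
  by (induction i) simp_all

text \<open>
  The differential of \<open>\<Lambda>\<close> commutes with the action.  At \<open>y\<close> both sides vanish except for the identity
  input, because \<open>\<lambda>U\<^sub>1 = 0 = U\<^sub>2\<lambda>\<close>.
\<close>

lemma op_L_leibniz:
  assumes "obj_mon2 a = rid_L m"
  shows "post A11 (\<lambda>n. op_L n [a]) (op_L m []) = post A11 (\<lambda>n. op_L n []) (op_L m [a])"
proof (cases m)
  case Gen_z
  have "post A11 (\<lambda>n. op_L n []) (op_L m [a]) = post A11 (\<lambda>n. 0) (op_L m [a])"
  proof (rule post_cong)
    fix c n assume "(c, n) \<in> Poly_Mapping.keys (op_L m [a])"
    then have "rid_L n = Obj_o"
      using word_L_keys[of c n m "word_mon2 a"] Gen_z assms by simp
    then show "op_L n [] = 0"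
      by (cases n) simp_all
  qed
  with Gen_z show ?thesis by simp
qed (use assms in \<open>cases a; simp add: word_L_xy post_basis_vec\<close>)+

lemma supported_Lambda: "supported A2 Lambda_bim"
proof -
  have "\<exists>t. path A2 (rid_L m) as t" if "op_L m as \<noteq> 0" for m as
    using that by (cases "(m, as)" rule: op_L.cases) (auto split: if_splits)
  then show ?thesis
    by (simp add: supported_def)
qed

lemma no_higher_Lambda: "no_higher Lambda_bim"
proof -
  have "op_L m as = 0" if "length as > 1" for m as
    using that by (cases "(m, as)" rule: op_L.cases) auto
  then show ?thesis
    by (simp add: no_higher_def)
qed

lemma da_bimodule_Lambda: "da_bimodule A11 A2 Lambda_bim"
proof (rule da_bimoduleI)
  have long: "da_op Lambda_bim n bs = 0" if "length bs \<ge> 2" for n bs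
    using that by (cases "(n, bs)" rule: op_L.cases) auto
  fix m as t
  assume p: "path A2 (rid Lambda_bim m) as t"
  show "da_rel A11 A2 Lambda_bim m as = 0"
  proof (cases as rule: short_list_cases)
    case 1
    then show ?thesis
      by (simp add: da_rel_def case_prod_beta' post_basis_vec)
  next
    case (2 a)
    with p show ?thesis
      using op_L_leibniz[of a m] by (simp add: da_rel_def case_prod_beta' del: op_L.simps)
  next
    case (3 a b)
    with p show ?thesis
      using op_L_mul[of a m b] by (simp add: da_rel_def case_prod_beta' atMost_Suc del:
          op_L.simps(1,2))
  next
    case 4
    then show ?thesis
      using long by (intro da_rel_long[where r = 2 and S = UNIV]) auto
  qed
  show "da_op Lambda_bim m as = 0" if "length as > 1" for s
    using long[of as m] that by simp
next
  fix m
  show "da_op Lambda_bim m [ident A2 (rid Lambda_bim m)] = basis_vec (ident A11 (lid Lambda_bim m),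
      m)"
    by (cases m) simp_all
qed (use dg_category_A11 dg_category_A2 op_L_keys in \<open>simp_all\<close>)

section \<open>The bimodule \<open>Y\<close>\<close>

lemma Y_sel [simp]: "gens Y_bim = UNIV" "lid Y_bim = lid_Y" "rid Y_bim = rid_Y"
  "qdeg Y_bim Gen_a = 0" "qdeg Y_bim Gen_b = 1" "qdeg Y_bim Gen_c = -1" "qdeg Y_bim Gen_d = 1"
  "hdeg Y_bim Gen_a = 1" "hdeg Y_bim Gen_b = 0" "hdeg Y_bim Gen_c = 2" "hdeg Y_bim Gen_d = 0"
  "da_op Y_bim = op_Y"
  by (simp_all add: Y_bim_def)

lemma step_Y_keys:
  "(c, n) \<in> Poly_Mapping.keys (step_Y m g) \<Longrightarrow>
      lft A2 c = lid_Y m \<and> rgt A2 c = lid_Y n \<and> rid_Y n = rid_Y m \<and>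
      qdeg Y_bim m + - 2 = cat_q A2 c + qdeg Y_bim n \<and>
      hdeg Y_bim m + 2 = cat_h A2 c + hdeg Y_bim n"
  by (cases m; cases g) (auto simp: keys_add_bit)

lemma word_Y_keys:
  assumes "(c, n) \<in> Poly_Mapping.keys (word_act A2 lid_Y step_Y m gs)"
  shows "lft A2 c = lid_Y m \<and> rgt A2 c = lid_Y n \<and> rid_Y n = rid_Y m \<and>
      qdeg Y_bim m + (\<Sum>g\<leftarrow>gs. - 2) = cat_q A2 c + qdeg Y_bim n \<and>
      hdeg Y_bim m + (\<Sum>g\<leftarrow>gs. 2) = cat_h A2 c + hdeg Y_bim n"
  by (rule A2.keys_word_act[OF step_Y_keys deg_ident_A2 assms])

lemma step_Y_commute:
  "post A2 (\<lambda>n. step_Y n h) (step_Y m g) = post A2 (\<lambda>n. step_Y n g) (step_Y m h)"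
  by (cases m; cases g; cases h) (simp_all add: post_basis_vec post_add algebra_simps)

lemma op_Y_Nil [simp]: "op_Y n [] = 0"
  by (cases n) simp_all

lemma supported_Y: "supported A11 Y_bim"
proof -
  have "\<exists>t. path A11 (rid_Y m) as t" if "op_Y m as \<noteq> 0" for m as
  proof (cases m)
    case Gen_a
    with that show ?thesis
      by (cases as rule: op_Y_a.cases) auto
  next
    case Gen_b
    with that show ?thesis
      by (cases as rule: op_Y_b.cases) auto
  next
    case Gen_c
    with that show ?thesis
      by (cases "(m, as)" rule: op_Y_cd.cases) auto
  next
    case Gen_d
    with that show ?thesis
      by (cases "(m, as)" rule: op_Y_cd.cases) auto
  qed
  then show ?thesis
    by (simp add: supported_def)
qed

lemma op_Y_cd_keys:
  assumes "rid_Y m = Obj_oo" "path A11 (rid_Y m) as t" "(c, n) \<in> Poly_Mapping.keys (op_Y_cd m as)"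
  shows "lft A2 c = lid_Y m \<and> rgt A2 c = lid_Y n \<and> rid_Y n = rid_Y m \<and> rid_Y n = t \<and>
    qdeg Y_bim m + inputs_q A11 as = cat_q A2 c + qdeg Y_bim n \<and>
    hdeg Y_bim m + inputs_h A11 as = (cat_h A2 c - 1) + hdeg Y_bim n"
  using assms
proof (cases "(m, as)" rule: op_Y_cd.cases)
  case (1 m' i j)
  with assms have "(c, n) \<in> Poly_Mapping.keys (word_act A2 lid_Y step_Y m (replicate i Gen_U1 @
      replicate j Gen_U2))"
    by simp
  from word_Y_keys[OF this] 1 assms show ?thesis
    by (auto simp: inputs_q_def inputs_h_def sum_list_replicate)
qed auto

lemma op_Y_keys:
  assumes "path A11 (rid_Y m) as t" "(c, n) \<in> Poly_Mapping.keys (op_Y m as)"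
  shows "lft A2 c = lid_Y m \<and> rgt A2 c = lid_Y n \<and> rid_Y n = t \<and>
    qdeg Y_bim m + inputs_q A11 as = cat_q A2 c + qdeg Y_bim n \<and>
    hdeg Y_bim m + inputs_h A11 as = (cat_h A2 c - 1) + hdeg Y_bim n"
proof (cases m)
  case Gen_a
  with assms show ?thesis
    by (cases as rule: op_Y_a.cases) (auto simp: inputs_q_def inputs_h_def)
next
  case Gen_b
  with assms show ?thesis
    by (cases as rule: op_Y_b.cases) (auto simp: inputs_q_def inputs_h_def)
qed (use assms op_Y_cd_keys[of m as t c n] in auto)

lemma da_rel_Y_a:
  assumes "path A11 Obj_ou as t"
  shows "da_rel A2 A11 Y_bim Gen_a as = 0"
proof (cases as rule: short_list_cases)
  case 4
  have "op_Y Gen_a bs = 0" if "length bs \<ge> 2" for bs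
    using that by (cases bs rule: op_Y_a.cases) auto
  moreover have "n = Gen_a" if "(c, n) \<in> Poly_Mapping.keys (op_Y Gen_a bs)" for c n bs
    using that by (cases bs rule: op_Y_a.cases) auto
  ultimately show ?thesis
    using 4 by (intro da_rel_long[where r = 2 and S = "{Gen_a}"]) auto
next
  case (2 a)
  with assms show ?thesis
    by (cases a) (simp_all add: da_rel_def post_basis_vec)
next
  case (3 a b)
  with assms show ?thesis
    by (cases a; cases b) (simp_all add: da_rel_def post_basis_vec atMost_Suc)
qed (simp add: da_rel_def)

lemma da_rel_Y_cd:
  assumes m: "m \<in> {Gen_c, Gen_d}" and p: "path A11 Obj_oo as t"
  shows "da_rel A2 A11 Y_bim m as = 0"
proof -
  have op: "op_Y n bs = op_Y_cd n bs" if "n \<in> {Gen_c, Gen_d}" for n bs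
    using that by auto
  have closed: "n' \<in> {Gen_c, Gen_d}"
      if "n \<in> {Gen_c, Gen_d}" "(c, n') \<in> Poly_Mapping.keys (op_Y n bs)" for n c n' bs
  proof (cases "(n, bs)" rule: op_Y_cd.cases)
    case (1 m' i j)
    with that have "rid_Y n' = Obj_oo"
      using word_Y_keys[of c n' n "replicate i Gen_U1 @ replicate j Gen_U2"] by (auto simp: op)
    then show ?thesis
      by (cases n') simp_all
  qed (use that op in auto)
  show ?thesis
  proof (cases as rule: short_list_cases)
    case 4
    have "op_Y n bs = 0" if "n \<in> {Gen_c, Gen_d}" "length bs \<ge> 2" for n bs
      using that by (cases "(n, bs)" rule: op_Y_cd.cases) auto
    then show ?thesis
      using 4 m closed by (intro da_rel_long[where r = 2 and S = "{Gen_c, Gen_d}"]) auto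
  next
    case (2 a)
    then show ?thesis
      by (simp add: da_rel_def case_prod_beta')
  next
    case (3 a b)
    with p obtain i j i' j' where ab: "a = M_oo i j" "b = M_oo i' j'"
      by (cases a; cases b) auto
    let ?w = "\<lambda>i j. replicate i Gen_U1 @ replicate j Gen_U2"
    have "post A2 (\<lambda>n. op_Y n [b]) (op_Y m [a]) =
        post A2 (\<lambda>n. word_act A2 lid_Y step_Y n (?w i' j')) (op_Y m [a])"
      by (rule post_cong) (use closed[OF m] ab in \<open>fastforce simp: op\<close>)
    also have "\<dots> = post A2 (\<lambda>n. word_act A2 lid_Y step_Y n (?w i' j')) (word_act A2 lid_Y step_Y m
        (?w i j))"
      using m ab by (simp add: op)
    also have "\<dots> = word_act A2 lid_Y step_Y m (?w (i + i') (j + j'))"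
      by (rule A2.word_act_normal_form) (simp_all add: step_Y_keys step_Y_commute del: lft_A2
          rgt_A2)
    also have "\<dots> = lin (\<lambda>c. op_Y m [c]) (mul A11 a b)"
      using m ab by (simp add: op)
    finally have "post A2 (\<lambda>n. op_Y n [b]) (op_Y m [a]) = \<dots>" .
    moreover have "op_Y m [a, b] = 0"
      using m by (auto simp: op)
    ultimately show ?thesis
      by (simp add: 3 da_rel_def atMost_Suc del: op_Y.simps)
  qed (simp add: da_rel_def)
qed

text \<open>
  At \<open>b\<close> the relation says, for instance for the inputs \<open>U\<^sub>2\<^sup>i, \<lambda>, U\<^sub>1\<^sup>j\<close>, that the two ways of reaching
  \<open>a\<close> through splits cancel if \<open>i\<close> and \<open>j\<close> are positive; if exactly one exponent is zero, the single
  surviving split cancels against the merge of \<open>\<lambda>\<close> with the identity.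
\<close>

lemma da_rel_Y_b:
  assumes "path A11 Obj_uo as t"
  shows "da_rel A2 A11 Y_bim Gen_b as = 0"
proof -
  have long: "op_Y n bs = 0" if "length bs \<ge> 3" for n bs
  proof (cases n)
    case Gen_a
    with that show ?thesis
      by (cases bs rule: op_Y_a.cases) auto
  next
    case Gen_b
    with that show ?thesis
      by (cases bs rule: op_Y_b.cases) auto
  next
    case Gen_c
    with that show ?thesis
      by (cases "(n, bs)" rule: op_Y_cd.cases) auto
  next
    case Gen_d
    with that show ?thesis
      by (cases "(n, bs)" rule: op_Y_cd.cases) auto
  qed
  have two: "op_Y_b [M_uo i, Lam] = (if i = 0 then 0 else basis_vec (Mon_u (i - 1), Gen_a))"
    "op_Y_b [Lam, M_ou i] = (if i = 0 then 0 else basis_vec (Mon_u (i - 1), Gen_a))"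
    "op_Y_b [M_uo i, M_uo j] = 0" for i j
    by (cases i; simp)+
  consider "as = []" | a where "as = [a]" | a b where "as = [a, b]" | a b c where "as = [a, b, c]"
    | a b c d where "as = [a, b, c, d]" | "length as \<ge> 5"
  proof (cases as rule: short_list_cases)
    case 4
    then obtain a b c ds where "as = a # b # c # ds"
      by (cases as rule: remdups_adj.cases) (auto simp: Suc_le_length_iff numeral_3_eq_3)
    with that show thesis
      by (cases ds; cases "tl ds") auto
  qed (use that in auto)
  then show ?thesis
  proof cases
    case (2 a)
    with assms show ?thesis
      by (cases a) (simp_all add: da_rel_def post_basis_vec)
  next
    case (3 a b)
    with assms show ?thesis
      by (cases a; cases b) (auto simp: da_rel_def post_basis_vec atMost_Suc two)
  next
    case (4 a b c)
    have "op_Y Gen_b [a, b, c] = 0"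
      using long by simp
    with 4 assms show ?thesis
      by (cases a; cases b; cases c)
        (auto simp: da_rel_def post_basis_vec atMost_Suc lessThan_Suc two simp flip: Suc_diff_Suc)
  next
    case (5 a b c d)
    have "op_Y n [x, y, z] = 0" "op_Y n [a, b, c, d] = 0" for n x y z
      using long by simp_all
    moreover have "post A2 (\<lambda>n. op_Y n [c, d]) (op_Y Gen_b [a, b]) = 0"
      using assms 5 by (cases a; cases b; cases c) (auto simp: post_basis_vec two)
    ultimately show ?thesis
      by (simp add: 5 da_rel_def atMost_Suc lessThan_Suc del: op_Y.simps)
  next
    case 6
    then show ?thesis
      using long by (intro da_rel_long[where r = 3 and S = UNIV]) auto
  qed (simp add: da_rel_def)
qed

lemma da_bimodule_Y: "da_bimodule A2 A11 Y_bim"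
proof (rule da_bimoduleI)
  show "dg_category A2" "dg_category A11"
    by (fact dg_category_A2 dg_category_A11)+
next
  fix m as t c n
  assume "path A11 (rid Y_bim m) as t" "(c, n) \<in> Poly_Mapping.keys (da_op Y_bim m as)"
  then have *: "path A11 (rid_Y m) as t" "(c, n) \<in> Poly_Mapping.keys (op_Y m as)"
    by simp_all
  show "n \<in> gens Y_bim \<and> lft A2 c = lid Y_bim m \<and> rgt A2 c = lid Y_bim n \<and> rid Y_bim n = t"
    "qdeg Y_bim m + inputs_q A11 as = cat_q A2 c + qdeg Y_bim n \<and>
      hdeg Y_bim m + inputs_h A11 as = (cat_h A2 c - 1) + hdeg Y_bim n"
    using op_Y_keys[OF *] by auto
next
  fix m as t
  assume "path A11 (rid Y_bim m) as t"
  then show "da_rel A2 A11 Y_bim m as = 0"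
    using da_rel_Y_a da_rel_Y_b da_rel_Y_cd by (cases m) auto
next
  fix m
  show "da_op Y_bim m [ident A11 (rid Y_bim m)] = basis_vec (ident A2 (lid Y_bim m), m)"
    by (cases m) simp_all
next
  fix m as t s
  assume *: "length as > 1" "ident A11 s \<in> set as"
  have cd: "op_Y_cd n as = 0" for n
    using * by (cases "(n, as)" rule: op_Y_cd.cases) auto
  have "op_Y_a as = 0"
    using * by (cases as rule: op_Y_a.cases) simp_all
  moreover have "op_Y_b as = 0"
    using * by (cases as rule: op_Y_b.cases; cases s) simp_all
  ultimately show "da_op Y_bim m as = 0"
    using cd by (cases m) auto
qed

section \<open>The singular crossing\<close>

lemma UNIV_obj11: "UNIV = {Obj_uu, Obj_ou, Obj_uo, Obj_oo}"
  using obj11.exhaust by auto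

lemma UNIV_wbasis: "UNIV = {W01, W11}"
  using wbasis.exhaust by auto

lemma UNIV_vbasis_pair: "UNIV = {(V0, V0), (V1, V0), (V0, V1), (V1, V1)}"
  using vbasis.exhaust by fast

lemma UNIV_genL: "UNIV = {Gen_x, Gen_y, Gen_z}"
  using genL.exhaust by auto

lemma UNIV_genY: "UNIV = {Gen_a, Gen_b, Gen_c, Gen_d}"
  using genY.exhaust by auto

instance genL :: finite
  by standard (simp add: UNIV_genL)

instance genY :: finite
  by standard (simp add: UNIV_genY)

lemma q_nonzero: "q \<noteq> 0"
  by (simp add: q_def Zero_fract_def eq_fract)

lemma gens_X_dual:
  "gens X_dual = {(Gen_a, Gen_x), (Gen_a, Gen_y), (Gen_b, Gen_x), (Gen_b, Gen_y), (Gen_c, Gen_z),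
      (Gen_d, Gen_z)}"
proof -
  have "gens X_dual = {(n, m). lid_Y n = rid_L m}"
    by (simp add: X_dual_def)
  also have "\<dots> = {(Gen_a, Gen_x), (Gen_a, Gen_y), (Gen_b, Gen_x), (Gen_b, Gen_y), (Gen_c, Gen_z),
      (Gen_d, Gen_z)}"
  proof (intro set_eqI, clarify)
    fix n m
    show "(n, m) \<in> {(n, m). lid_Y n = rid_L m} \<longleftrightarrow>
      (n, m) \<in> {(Gen_a, Gen_x), (Gen_a, Gen_y), (Gen_b, Gen_x), (Gen_b, Gen_y), (Gen_c, Gen_z),
          (Gen_d, Gen_z)}"
      by (cases n; cases m) simp_all
  qed
  finally show ?thesis .
qed

text \<open>
  The matrix of \<open>[\<^sup>\<or>X]\<close>, with entries the graded Euler characteristics of the spaces \<open>\<^sup>\<or>X(t, s)\<close>.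
\<close>

definition X_matrix :: "obj11 \<Rightarrow> obj11 \<Rightarrow> Cq"
  where "X_matrix t s = (\<Sum>n\<in>{n \<in> gens X_dual. lid X_dual n = t \<and> rid X_dual n = s}.
       (- 1) powi hdeg X_dual n * q powi qdeg X_dual n)"

lemma X_matrix_entries:
  "X_matrix t s = (case (t, s) of (Obj_ou, Obj_ou) \<Rightarrow> q | (Obj_ou, Obj_uo) \<Rightarrow> - 1 | (Obj_uo, Obj_ou)
      \<Rightarrow> - 1
     | (Obj_uo, Obj_uo) \<Rightarrow> inverse q | (Obj_oo, Obj_oo) \<Rightarrow> q + inverse q | _ \<Rightarrow> 0)"
proof -
  have "X_matrix t s = (\<Sum>n\<in>gens X_dual. if lid X_dual n = t \<and> rid X_dual n = s
       then (- 1) powi hdeg X_dual n * q powi qdeg X_dual n else 0)"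
    unfolding X_matrix_def by (intro sum.inter_filter) (simp add: gens_X_dual)
  then show ?thesis
    unfolding gens_X_dual
    by (cases t; cases s) (simp_all add: X_dual_def power_int_minus)
qed

lemma decat_X_dual: "decat X_dual v $ t = (\<Sum>s\<in>UNIV. X_matrix t s * v $ s)"
  by (simp add: decat_def X_matrix_def matrix_vector_mult_def)

lemma decat_X_dual_axis: "decat X_dual (axis s 1) $ t = X_matrix t s"
  unfolding decat_X_dual by (simp add: axis_def if_distrib cong: if_cong)

lemma lin_ext_nth: "lin_ext f v $ i = (\<Sum>b\<in>UNIV. v $ b * f b $ i)"
  by (simp add: lin_ext_def)

lemma lin_ext_axis: "lin_ext f (axis b 1) = f b"
  by (simp add: vec_eq_iff lin_ext_nth axis_def if_distrib if_distribR cong: if_cong)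

lemma linear_lin_ext: "Vector_Spaces.linear (*s) (*s) (lin_ext f)"
proof -
  have "lin_ext f = (*v) (\<chi> i b. f b $ i)"
    by (auto simp: vec_eq_iff lin_ext_nth matrix_vector_mult_def mult.commute)
  then show ?thesis
    by (simp add: matrix_vector_mul_linear_gen)
qed

lemma G0_to_VV_nth: "G0_to_VV v $ ket s = v $ s"
  unfolding G0_to_VV_def lin_ext_nth by (cases s) (simp_all add: UNIV_obj11 axis_def)

lemma ket_surj: "\<exists>s. p = ket s"
  by (cases p; cases "fst p"; cases "snd p") (metis ket.simps fst_conv snd_conv)+

lemma bij_G0_to_VV: "bij G0_to_VV"
proof (rule bijI)
  show "inj G0_to_VV"
    by (rule injI) (metis G0_to_VV_nth vec_eq_iff)
  show "surj G0_to_VV"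
  proof (rule surjI)
    fix w :: "Cq ^ (vbasis \<times> vbasis)"
    show "G0_to_VV (\<chi> s. w $ ket s) = w"
      unfolding vec_eq_iff by (metis G0_to_VV_nth ket_surj vec_lambda_beta)
  qed
qed

lemma singular_crossing_nth:
  "singular_crossing w $ (V0, V0) = 0"
  "singular_crossing w $ (V1, V0) = q * w $ (V1, V0) - w $ (V0, V1)"
  "singular_crossing w $ (V0, V1) = inverse q * w $ (V0, V1) - w $ (V1, V0)"
  "singular_crossing w $ (V1, V1) = (q + inverse q) * w $ (V1, V1)"
  using q_nonzero
  by (simp_all add: singular_crossing_def howe_F_def howe_E_def lin_ext_nth UNIV_wbasis
      UNIV_vbasis_pair axis_def field_simps)

lemma categorifies_X_dual: "categorifies X_dual singular_crossing"
  unfolding categorifies_def vec_eq_iff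
proof (intro allI)
  fix v p
  obtain s where p: "p = ket s"
    using ket_surj by blast
  have "G0_to_VV v $ (V1, V0) = v $ Obj_ou" "G0_to_VV v $ (V0, V1) = v $ Obj_uo"
      "G0_to_VV v $ (V1, V1) = v $ Obj_oo"
    using G0_to_VV_nth[of v Obj_ou] G0_to_VV_nth[of v Obj_uo] G0_to_VV_nth[of v Obj_oo] by simp_all
  then show "G0_to_VV (decat X_dual v) $ p = singular_crossing (G0_to_VV v) $ p"
    unfolding p G0_to_VV_nth decat_X_dual
    by (cases s) (simp_all add: UNIV_obj11 X_matrix_entries singular_crossing_nth)
qed

lemma axis_nth: "axis i (1 :: Cq) $ j = (if j = i then 1 else 0)"
  by (simp add: axis_def)

lemma V_axis [simp]:
  "V_E (axis V0 1) = 0" "V_E (axis V1 1) = axis V0 1" "V_F (axis V0 1) = axis V1 1"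
      "V_F (axis V1 1) = 0"
  "V_H1 n (axis V0 1) = (q powi n) *s axis V0 1" "V_H1 n (axis V1 1) = axis V1 1"
  "V_H2 n (axis V0 1) = axis V0 1" "V_H2 n (axis V1 1) = (q powi n) *s axis V1 1"
  by (simp_all add: V_E_def V_F_def V_H1_def V_H2_def lin_ext_axis)

lemma V_H_scale: "V_H1 n (c *s v) = c *s V_H1 n v" "V_H2 n (c *s v) = c *s V_H2 n v"
  by (simp_all add: V_H1_def V_H2_def vec_eq_iff lin_ext_nth sum_distrib_left mult.assoc)

lemma tensor_op_nth: "tensor_op f b g w $ (i, j) =
    w $ (V0, V0) * (f (axis V0 1) $ i * g (axis V0 1) $ j)
    + w $ (V1, V0) * ((if b then - 1 else 1) * (f (axis V1 1) $ i * g (axis V0 1) $ j))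
    + w $ (V0, V1) * (f (axis V0 1) $ i * g (axis V1 1) $ j)
    + w $ (V1, V1) * ((if b then - 1 else 1) * (f (axis V1 1) $ i * g (axis V1 1) $ j))"
  by (simp add: tensor_op_def lin_ext_nth UNIV_vbasis_pair tensor_vec_def)

lemma VV_E_nth:
  "VV_E w $ (V0, V0) = inverse q * w $ (V1, V0) + w $ (V0, V1)"
  "VV_E w $ (V1, V0) = - w $ (V1, V1)"
  "VV_E w $ (V0, V1) = inverse q * w $ (V1, V1)"
  "VV_E w $ (V1, V1) = 0"
  by (simp_all add: VV_E_def tensor_op_nth V_H_scale axis_nth)

lemma VV_F_nth:
  "VV_F w $ (V0, V0) = 0"
  "VV_F w $ (V1, V0) = w $ (V0, V0)"
  "VV_F w $ (V0, V1) = q * w $ (V0, V0)"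
  "VV_F w $ (V1, V1) = w $ (V0, V1) - q * w $ (V1, V0)"
  by (simp_all add: VV_F_def tensor_op_nth V_H_scale axis_nth)

lemma VV_H_nth:
  "VV_H1 n w $ (V0, V0) = q powi n * q powi n * w $ (V0, V0)"
  "VV_H1 n w $ (V1, V0) = q powi n * w $ (V1, V0)"
  "VV_H1 n w $ (V0, V1) = q powi n * w $ (V0, V1)"
  "VV_H1 n w $ (V1, V1) = w $ (V1, V1)"
  "VV_H2 n w $ (V0, V0) = w $ (V0, V0)"
  "VV_H2 n w $ (V1, V0) = q powi n * w $ (V1, V0)"
  "VV_H2 n w $ (V0, V1) = q powi n * w $ (V0, V1)"
  "VV_H2 n w $ (V1, V1) = q powi n * q powi n * w $ (V1, V1)"
  by (simp_all add: VV_H1_def VV_H2_def tensor_op_nth axis_nth)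

lemma vec_eq_VV: "v = w \<longleftrightarrow> v $ (V0, V0) = w $ (V0, V0) \<and> v $ (V1, V0) = w $ (V1, V0) \<and>
    v $ (V0, V1) = w $ (V0, V1) \<and> v $ (V1, V1) = w $ (V1, V1)"
  for v w :: "Cq ^ (vbasis \<times> vbasis)"
proof -
  have "v = w \<longleftrightarrow> (\<forall>p\<in>UNIV. v $ p = w $ p)"
    by (simp add: vec_eq_iff)
  then show ?thesis
    unfolding UNIV_vbasis_pair by simp
qed

lemma intertwiner_singular_crossing: "intertwiner singular_crossing"
proof -
  have "singular_crossing (g w) = g (singular_crossing w)"
    if "g \<in> {VV_E, VV_F, VV_H1 1, VV_H1 (-1), VV_H2 1, VV_H2 (-1)}" for g w
    using that q_nonzero
    by (auto simp: vec_eq_VV singular_crossing_nth VV_E_nth VV_F_nth VV_H_nth field_simps)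
  moreover have "Vector_Spaces.linear (*s) (*s) singular_crossing"
    unfolding singular_crossing_def howe_F_def howe_E_def
    by (rule Vector_Spaces.linear_compose[OF linear_lin_ext linear_lin_ext])
  ultimately show ?thesis
    unfolding intertwiner_def by (auto simp: fun_eq_iff)
qed

interpretation Lambda_Y: da_box_pair A11 A2 A11 Lambda_bim Y_bim
  by (intro da_box_pair.intro da_box_pair_axioms.intro da_bimodule_Lambda da_bimodule_Y
      no_higher_Lambda supported_Y)

lemma ad_iso_X_dual: "ad_iso_by A11 prod.swap (left_dual X_bim) X_dual"
  unfolding ad_iso_by_def
proof (intro conjI ballI allI impI)
  show "bij_betw prod.swap (gens (left_dual X_bim)) (gens X_dual)"
    by (rule bij_betwI[where g = prod.swap]) (auto simp: X_bim_def X_dual_def)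
  fix n assume n: "n \<in> gens (left_dual X_bim)"
  show "lid X_dual (prod.swap n) = lid (left_dual X_bim) n"
      "rid X_dual (prod.swap n) = rid (left_dual X_bim) n"
    "qdeg X_dual (prod.swap n) = qdeg (left_dual X_bim) n"
        "hdeg X_dual (prod.swap n) = hdeg (left_dual X_bim) n"
    by (auto simp: X_bim_def X_dual_def case_prod_beta')
  fix s cs
  show "ad_op X_dual cs (prod.swap n) = lin (\<lambda>(m, a). basis_vec (prod.swap m, a))
      (ad_op (left_dual X_bim) cs n)"
    using Lambda_Y.ad_op_left_dual_box[of "fst n" "snd n" cs, OF _ _ supported_Lambda] n
    by (auto simp: X_bim_def X_dual_def)
qed

lemma ad_bimodule_X_dual: "ad_bimodule A11 A11 X_dual"
proof (rule ad_bimodule_transfer[OF _ ad_iso_X_dual])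
  show "ad_bimodule A11 A11 (left_dual X_bim)"
    unfolding X_bim_def
  proof (rule da_bimodule.ad_bimodule_left_dual)
    show "finite (gens (da_box Lambda_bim Y_bim))"
      by (rule finite_subset[OF subset_UNIV]) simp
  qed (fact Lambda_Y.da_bimodule_box Lambda_Y.supported_box)+
qed

theorem corollary1p4:
  shows "da_bimodule A11 A2 Lambda_bim \<and> da_bimodule A2 A11 Y_bim
    \<and> ad_bimodule A11 A2 (left_dual Y_bim) \<and> ad_bimodule A2 A11 (left_dual Lambda_bim)
    \<and> ad_box_defined A11 (left_dual Y_bim) (left_dual Lambda_bim)
    \<and> ad_bimodule A11 A11 X_dual \<and> finite (gens X_dual)
    \<and> da_box_defined A11 Lambda_bim Y_bim \<and> da_bimodule A11 A11 X_bim
    \<and> ad_iso_by A11 prod.swap (left_dual X_bim) X_dual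
    \<and> bij G0_to_VV
    \<and> intertwiner singular_crossing
    \<and> categorifies X_dual singular_crossing
    \<and> (let ord = [Obj_uu, Obj_ou, Obj_uo, Obj_oo] in
        \<forall>i<4. \<forall>j<4. decat X_dual (axis (ord ! j) 1) $ (ord ! i) =
          [[0,   0,         0,             0],
           [0,   q,       - 1,             0],
           [0, - 1, inverse q,             0],
           [0,   0,         0, q + inverse q]] ! i ! j)"
proof (intro conjI)
  show "ad_bimodule A11 A2 (left_dual Y_bim)"
    by (rule da_bimodule.ad_bimodule_left_dual[OF da_bimodule_Y _ supported_Y]) simp
  show "ad_bimodule A2 A11 (left_dual Lambda_bim)"
    by (rule da_bimodule.ad_bimodule_left_dual[OF da_bimodule_Lambda _ supported_Lambda]) simp
  show "da_bimodule A11 A11 X_bim"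
    unfolding X_bim_def by (fact Lambda_Y.da_bimodule_box)
  show "finite (gens X_dual)"
    by (simp add: gens_X_dual)
  show "let ord = [Obj_uu, Obj_ou, Obj_uo, Obj_oo] in
        \<forall>i<4. \<forall>j<4. decat X_dual (axis (ord ! j) 1) $ (ord ! i) =
          [[0,   0,         0,             0],
           [0,   q,       - 1,             0],
           [0, - 1, inverse q,             0],
           [0,   0,         0, q + inverse q]] ! i ! j"
    unfolding Let_def decat_X_dual_axis X_matrix_entries
    by (simp add: numeral_eq_Suc All_less_Suc)
qed (fact da_bimodule_Lambda da_bimodule_Y ad_bimodule_X_dual ad_iso_X_dual bij_G0_to_VV
    intertwiner_singular_crossing categorifies_X_dual
    | rule ad_box_defined_left_dual da_box_defined_no_higher, rule no_higher_Lambda)+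

end
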